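(* For every positive integer $n$, the number of fb-tableaux of size $n$ in the spine of $\operatorname{esTam}_n$ is $$\sum_{\substack{i,j,k\ge0\\ i+j+k=n-1}}f(i,j,k),\qquad f(i,j,k)=2^{i(i-1)/2+k(k-1)/2}\,g(i,j,k),$$ where the numbers $g(i,j,k)$ are defined by $g(i,j,k)=0$ if $i<0$, $j<0$ or $k<0$; $g(m,0,0)=g(0,0,m)=1$ for $m\ge0$; and the recurrences for $i,k\ge0$ and $j>1$: $$g(i,j,k)=(2^{i+1}-1)g(i+1,j-1,k)+(2^{k+1}-1)g(i,j-1,k+1)-(2^{i+1}-1)(2^{k+1}-1)g(i+1,j-2,k+1);$$ for $i,k\ge0$: $$g(i,1,k)=(2^{i+1}-1)g(i+1,0,k)+(2^{k+1}-1)g(i,0,k+1)-(2^{i+1}-1)(2^{k+1}-1)g(i,0,k);$$ for $i,k\ge1$: $$g(i,0,k)=(2^{i+1}-1)g(i,0,k-1)+(2^{k+1}-1)g(i-1,0,k)-2(2^i-1)(2^k-1)g(i-1,0,k-1).$$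
   Context: Let $n$ be a positive integer. The board of size $n$ is the Ferrers diagram of shape $(n,n,n-1,n-2,\dots,3,2)$ (a single cell $(1,1)$ if $n=1$). Its cells are written $(i,j)$, where $i$ is the row, numbered from the top, and $j$ is the column label, the columns being labelled $n,n-1,\dots,1$ from left to right. So the cells are $(1,j)$ for $1\le j\le n$ and $(i,j)$ for $2\le i\le n$, $i-1\le j\le n$. The root is $(1,n)$ (top-left cell); the border cells are $(i,i-1)$ for $2\le i\le n$ (the rightmost cells of rows $2,\dots,n$). An fb-tableau of size $n$ is a filling in which each cell is either empty or nonempty such that the root and all border cells are nonempty, and every nonempty cell other than the root has a nonempty cell strictly to its left in the same row or strictly above it in the same column. In an fb-tableau, a nonempty cell different from the root is called a left-arrow if there is no nonempty cell strictly to its left in its row, an up-arrow if there is no nonempty cell strictly above it in its column, and a dot otherwise; the root is also a dot. (Each of rows $2,\dots,n$ has exactly one left-arrow, each of columns $1,\dots,n-1$ has exactly one up-arrow.) A cell is free in $T$ if it lies strictly below an up-arrow (same column) and strictly to the right of a left-arrow (same row); a free cell is either empty or contains a dot. $\operatorname{Row}(T)$ is the set of cells lying weakly to the right of a left-arrow or of the root in the same row; $\operatorname{Col}(T)$ is the set of cells lying weakly below an up-arrow or the root in the same column. For fb-tableaux $S,T$ of size $n$, write $S\lhd T$ if (1) $\operatorname{Col}(S)\subseteq\operatorname{Col}(T)$; (2) $\operatorname{Row}(T)\subseteq\operatorname{Row}(S)$; (3) for every cell $c$ that is free in both $S$ and $T$, if $c$ contains a dot in $S$ then $c$ contains a dot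 in $T$. The extra slow Tamari lattice $\operatorname{esTam}_n$ is the set of fb-tableaux of size $n$ ordered by $\lhd$; it is a finite (trim) lattice. Its spine is the set of elements that belong to some chain of maximum length. *)

theory Defs
  imports Main
begin

section \<open>The board\<close>

text \<open>
  A cell is a pair of a row, numbered from the top, and a column label. Labels decrease from left
  to right, so of two cells in a row the one with the larger label is further to the left.
\<close>

type_synonym cell = "nat \<times> nat"

definition board :: "nat \<Rightarrow> cell set" where
  "board n = {(1, j) | j. 1 \<le> j \<and> j \<le> n} \<union> {(i, j) | i j. 2 \<le> i \<and> i \<le> n \<and> i - 1 \<le> j \<and> j \<le> n}"

definition root :: "nat \<Rightarrow> cell" where
  "root n = (1, n)"

definition border :: "nat \<Rightarrow> cell set" where
  "border n = {(i, i - 1) | i. 2 \<le> i \<and> i \<le> n}"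

definition strictly_left :: "cell \<Rightarrow> cell \<Rightarrow> bool" where
  "strictly_left d c \<longleftrightarrow> fst d = fst c \<and> snd d > snd c"

definition strictly_above :: "cell \<Rightarrow> cell \<Rightarrow> bool" where
  "strictly_above d c \<longleftrightarrow> snd d = snd c \<and> fst d < fst c"


section \<open>Tableaux, represented by their sets of nonempty cells\<close>

definition fb_tableau :: "nat \<Rightarrow> cell set \<Rightarrow> bool" where
  "fb_tableau n T \<longleftrightarrow>
     T \<subseteq> board n \<and> root n \<in> T \<and> border n \<subseteq> T \<and>
     (\<forall>c\<in>T. c \<noteq> root n \<longrightarrow> (\<exists>d\<in>T. strictly_left d c \<or> strictly_above d c))"

definition left_arrow :: "nat \<Rightarrow> cell set \<Rightarrow> cell \<Rightarrow> bool" where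
  "left_arrow n T c \<longleftrightarrow> c \<in> T \<and> c \<noteq> root n \<and> \<not> (\<exists>d\<in>T. strictly_left d c)"

definition up_arrow :: "nat \<Rightarrow> cell set \<Rightarrow> cell \<Rightarrow> bool" where
  "up_arrow n T c \<longleftrightarrow> c \<in> T \<and> c \<noteq> root n \<and> \<not> (\<exists>d\<in>T. strictly_above d c)"

definition dot :: "nat \<Rightarrow> cell set \<Rightarrow> cell \<Rightarrow> bool" where
  "dot n T c \<longleftrightarrow> c \<in> T \<and> \<not> left_arrow n T c \<and> \<not> up_arrow n T c"

definition free_cell :: "nat \<Rightarrow> cell set \<Rightarrow> cell \<Rightarrow> bool" where
  "free_cell n T c \<longleftrightarrow> c \<in> board n \<and>
     (\<exists>u. up_arrow n T u \<and> strictly_above u c) \<and> (\<exists>l. left_arrow n T l \<and> strictly_left l c)"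

definition Row :: "nat \<Rightarrow> cell set \<Rightarrow> cell set" where
  "Row n T = {c \<in> board n. \<exists>l. (left_arrow n T l \<or> l = root n) \<and> (l = c \<or> strictly_left l c)}"

definition Col :: "nat \<Rightarrow> cell set \<Rightarrow> cell set" where
  "Col n T = {c \<in> board n. \<exists>u. (up_arrow n T u \<or> u = root n) \<and> (u = c \<or> strictly_above u c)}"


section \<open>The extra slow Tamari lattice and its spine\<close>

definition es_le :: "nat \<Rightarrow> cell set \<Rightarrow> cell set \<Rightarrow> bool" where
  "es_le n S T \<longleftrightarrow>
     Col n S \<subseteq> Col n T \<and>
     Row n T \<subseteq> Row n S \<and>
     (\<forall>c. free_cell n S c \<and> free_cell n T c \<and> dot n S c \<longrightarrow> dot n T c)"

definition esTam :: "nat \<Rightarrow> cell set rel" where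
  "esTam n = {(S, T). fb_tableau n S \<and> fb_tableau n T \<and> es_le n S T}"

text \<open>
  The maximum is taken with respect to \<^const>\<open>card\<close>, so this is meaningful only if all chains of
  the relation are finite; \<open>finite_Chains_esTam\<close> below shows this for \<^const>\<open>esTam\<close>.
\<close>

definition spine :: "'a rel \<Rightarrow> 'a set" where
  "spine r = \<Union> {C \<in> Chains r. \<forall>D \<in> Chains r. card D \<le> card C}"

lemma finite_board: "finite (board n)"
proof (rule finite_subset)
  show "board n \<subseteq> {..Suc n} \<times> {..n}"
    by (auto simp: board_def)
qed auto

lemma finite_fb_tableaux: "finite {T. fb_tableau n T}"
  by (rule finite_subset[of _ "Pow (board n)"]) (auto simp: fb_tableau_def finite_board)

lemma Chains_esTam_subset: "C \<in> Chains (esTam n) \<Longrightarrow> C \<subseteq> {T. fb_tableau n T}"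
  by (auto simp: Chains_def esTam_def)

lemma finite_Chains_esTam: "C \<in> Chains (esTam n) \<Longrightarrow> finite C"
  using Chains_esTam_subset finite_fb_tableaux finite_subset by metis

lemma es_le_refl: "es_le n T T"
  by (simp add: es_le_def)


section \<open>The counting functions\<close>

text \<open>
  The recurrences only refer to nonnegative indices, so the convention that \<open>g\<close> vanishes if some
  index is negative is not needed for natural number indices. The values are integers because of
  the subtractions.
\<close>

fun spine_g :: "nat \<Rightarrow> nat \<Rightarrow> nat \<Rightarrow> int" where
  "spine_g i 0 0 = 1"
| "spine_g 0 0 (Suc k) = 1"
| "spine_g (Suc i) 0 (Suc k) =
     (2 ^ (Suc i + 1) - 1) * spine_g (Suc i) 0 k
     + (2 ^ (Suc k + 1) - 1) * spine_g i 0 (Suc k)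
     - 2 * (2 ^ Suc i - 1) * (2 ^ Suc k - 1) * spine_g i 0 k"
| "spine_g i (Suc 0) k =
     (2 ^ (i + 1) - 1) * spine_g (i + 1) 0 k
     + (2 ^ (k + 1) - 1) * spine_g i 0 (k + 1)
     - (2 ^ (i + 1) - 1) * (2 ^ (k + 1) - 1) * spine_g i 0 k"
| "spine_g i (Suc (Suc j)) k =
     (2 ^ (i + 1) - 1) * spine_g (i + 1) (Suc j) k
     + (2 ^ (k + 1) - 1) * spine_g i (Suc j) (k + 1)
     - (2 ^ (i + 1) - 1) * (2 ^ (k + 1) - 1) * spine_g (i + 1) j (k + 1)"

definition spine_f :: "nat \<Rightarrow> nat \<Rightarrow> nat \<Rightarrow> int" where
  "spine_f i j k = 2 ^ (i * (i - 1) div 2 + k * (k - 1) div 2) * spine_g i j k"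

end

theory Submission
  imports Defs "HOL-Library.FuncSet"
begin

text \<open>
  For a cell off the first row and the leftmost column, record whether some nonempty cell lies above
  it and whether some nonempty cell lies to its left. Going up in the lattice, the first property can
  only be gained, the second only be lost, and a cell having both can only acquire a dot; so
  the lattice embeds in a product of small orders \<open>0 < 1 < 2 < 3\<close> and \<open>0 < X < 3\<close>, where \<open>0\<close> stands for nothing above,
  \<open>3\<close> for nothing to the left, \<open>1\<close> and \<open>2\<close> for a free cell without and with a dot, and \<open>X\<close> for neither
  above nor left. A chain of maximum length moves every cell through all of \<open>0, 1, 2, 3\<close> (a border
  cell through \<open>0, 2, 3\<close>), and conversely every tableau without state \<open>X\<close> can be moved up or down
  by a single step. Hence the spine consists of the fillings of a staircase by \<open>0, 1, 2, 3\<close>, in which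
  the zeros are at the top of each column, the threes at the left of each row, and no border cell is \<open>1\<close>.

  To count them, let \<open>i\<close> be the leftmost column with border entry \<open>0\<close> and let \<open>t + 1\<close> be the topmost row
  with border entry \<open>3\<close>. That column and that row are constant; to the right of the column and
  below the row there remain two triangles, without threes and without zeros respectively, which
  contribute the powers of \<open>2\<close>. In the remaining region all border entries are \<open>2\<close>, and its fillings
  are counted by \<open>g\<close>: its rightmost column has no three or its bottom row has no zero (a full row of
  threes would meet a full column of zeros), and inclusion-exclusion gives the recurrences.
\<close>

section \<open>Fillings\<close>

text \<open>Zeros spread upwards in a column and threes spread to the left in a row. Fillings are
  extensional, so that they are determined by their values on \<open>A\<close> and can be counted;
  \<open>V\<close> is a parameter so that values can be forbidden or prescribed cell by
  cell.\<close>

definition fillings :: "cell set \<Rightarrow> (cell \<Rightarrow> nat set) \<Rightarrow> (cell \<Rightarrow> nat) set" where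
  "fillings A V = {f \<in> Pi\<^sub>E A V.
     (\<forall>x\<in>A. \<forall>y\<in>A. strictly_above x y \<longrightarrow> f y = 0 \<longrightarrow> f x = 0) \<and>
     (\<forall>x\<in>A. \<forall>y\<in>A. strictly_left x y \<longrightarrow> f y = 3 \<longrightarrow> f x = 3)}"

lemma fillingsI:
  assumes "f \<in> Pi\<^sub>E A V"
    and "\<And>x y. x \<in> A \<Longrightarrow> y \<in> A \<Longrightarrow> strictly_above x y \<Longrightarrow> f y = 0 \<Longrightarrow> f x = 0"
    and "\<And>x y. x \<in> A \<Longrightarrow> y \<in> A \<Longrightarrow> strictly_left x y \<Longrightarrow> f y = 3 \<Longrightarrow> f x = 3"
  shows "f \<in> fillings A V"
  using assms by (auto simp: fillings_def)

lemma fillings_above: "f \<in> fillings A V \<Longrightarrow> f y = 0 \<Longrightarrow> strictly_above x y \<Longrightarrow> x \<in> A \<Longrightarrow> y \<in> A \<Longrightarrow> f x = 0"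
  unfolding fillings_def by blast

lemma fillings_left: "f \<in> fillings A V \<Longrightarrow> f y = 3 \<Longrightarrow> strictly_left x y \<Longrightarrow> x \<in> A \<Longrightarrow> y \<in> A \<Longrightarrow> f x = 3"
  unfolding fillings_def by blast

lemma fillings_mem: "f \<in> fillings A V \<Longrightarrow> x \<in> A \<Longrightarrow> f x \<in> V x"
  unfolding fillings_def by auto

lemma fillings_outside: "f \<in> fillings A V \<Longrightarrow> x \<notin> A \<Longrightarrow> f x = undefined"
  unfolding fillings_def PiE_def extensional_def by blast

lemma fillings_restrict_values:
  assumes "f \<in> fillings A V" "\<And>x. x \<in> A \<Longrightarrow> f x \<in> W x"
  shows "f \<in> fillings A W"
  using assms unfolding fillings_def PiE_def by blast

lemma fillings_mono: "(\<And>x. x \<in> A \<Longrightarrow> V x \<subseteq> W x) \<Longrightarrow> fillings A V \<subseteq> fillings A W"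
  using fillings_restrict_values[of _ A V W] fillings_mem[of _ A V] by blast

lemma fillings_cong: "(\<And>x. x \<in> A \<Longrightarrow> V x = W x) \<Longrightarrow> fillings A V = fillings A W"
  using fillings_mono[of A V W] fillings_mono[of A W V] by auto

lemma finite_fillings:
  assumes "finite A" "\<And>x. x \<in> A \<Longrightarrow> finite (V x)"
  shows "finite (fillings A V)"
  by (rule finite_subset[of _ "Pi\<^sub>E A V"]) (auto simp: fillings_def intro!: finite_PiE assms)

lemma fillings_empty [simp]: "fillings {} V = {\<lambda>_. undefined}"
  by (auto simp: fillings_def)

text \<open>The second assumption says that no two cells from different parts constrain each other.\<close>

lemma card_fillings_Un:
  assumes disj: "A \<inter> B = {}"
    and indep: "\<And>x y. x \<in> A \<and> y \<in> B \<or> x \<in> B \<and> y \<in> A \<Longrightarrow>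
      (strictly_above x y \<longrightarrow> 0 \<notin> V y \<or> V x \<subseteq> {0}) \<and> (strictly_left x y \<longrightarrow> 3 \<notin> V y \<or> V x \<subseteq> {3})"
  shows "card (fillings (A \<union> B) V) = card (fillings A V) * card (fillings B V)"
proof -
  define glue where "glue g h x = (if x \<in> A then g x else h x)" for g h :: "cell \<Rightarrow> nat" and x
  have glue_A: "glue g h x = g x" if "x \<in> A" for g h x using that by (simp add: glue_def)
  have glue_B: "glue g h x = h x" if "x \<notin> A" for g h x using that by (simp add: glue_def)
  have "bij_betw (\<lambda>f. (restrict f A, restrict f B)) (fillings (A \<union> B) V) (fillings A V \<times> fillings B V)"
  proof (rule bij_betw_byWitness[where f' = "\<lambda>(g, h). glue g h"])
    show "\<forall>f\<in>fillings (A \<union> B) V. (\<lambda>(g, h). glue g h) (restrict f A, restrict f B) = f"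
    proof
      fix f assume "f \<in> fillings (A \<union> B) V"
      then have "f x = undefined" if "x \<notin> A \<union> B" for x
        using that by (rule fillings_outside)
      then show "(\<lambda>(g, h). glue g h) (restrict f A, restrict f B) = f"
        by (intro ext) (auto simp: glue_def restrict_def)
    qed
    show "\<forall>p\<in>fillings A V \<times> fillings B V.
      (\<lambda>f. (restrict f A, restrict f B)) ((\<lambda>(g, h). glue g h) p) = p"
    proof (rule ballI, elim SigmaE)
      fix p g h assume g: "g \<in> fillings A V" and h: "h \<in> fillings B V" and p: "p = (g, h)"
      have "restrict (glue g h) A = g" "restrict (glue g h) B = h"
        using disj fillings_outside[OF g] fillings_outside[OF h]
        by (auto simp: glue_def restrict_def fun_eq_iff)
      then show "(\<lambda>f. (restrict f A, restrict f B)) ((\<lambda>(g, h). glue g h) p) = p" by (simp add: p)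
    qed
    have "restrict f C \<in> fillings C V" if f: "f \<in> fillings (A \<union> B) V" and C: "C \<subseteq> A \<union> B" for f C
    proof (rule fillingsI)
      show "restrict f C \<in> Pi\<^sub>E C V" using C fillings_mem[OF f] by (intro restrict_PiE_iff[THEN iffD2]) blast
    next
      fix x y assume "x \<in> C" "y \<in> C" "strictly_above x y" "restrict f C y = 0"
      then show "restrict f C x = 0" using subsetD[OF C] fillings_above[OF f, of y x] by simp
    next
      fix x y assume "x \<in> C" "y \<in> C" "strictly_left x y" "restrict f C y = 3"
      then show "restrict f C x = 3" using subsetD[OF C] fillings_left[OF f, of y x] by simp
    qed
    then show "(\<lambda>f. (restrict f A, restrict f B)) ` fillings (A \<union> B) V \<subseteq> fillings A V \<times> fillings B V"
      by auto
    show "(\<lambda>(g, h). glue g h) ` (fillings A V \<times> fillings B V) \<subseteq> fillings (A \<union> B) V"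
    proof clarify
      fix g h assume g: "g \<in> fillings A V" and h: "h \<in> fillings B V"
      have fA: "glue g h x = g x" if "x \<in> A" for x using that by (rule glue_A)
      have fB: "glue g h x = h x" if "x \<in> B" for x using that disj by (intro glue_B) blast
      have mem: "glue g h x \<in> V x" if "x \<in> A \<union> B" for x
      proof (cases "x \<in> A")
        case True then show ?thesis using fA fillings_mem[OF g] by simp
      next
        case False then show ?thesis using that fB fillings_mem[OF h] by simp
      qed
      show "glue g h \<in> fillings (A \<union> B) V"
      proof (rule fillingsI)
        have "glue g h x = undefined" if "x \<notin> A \<union> B" for x
          using that fillings_outside[OF h] by (simp add: glue_def)
        then show "glue g h \<in> Pi\<^sub>E (A \<union> B) V"
          using mem by (intro PiE_I) auto
      next
        fix x y assume xy: "x \<in> A \<union> B" "y \<in> A \<union> B" "strictly_above x y" "glue g h y = 0"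
        consider "x \<in> A" "y \<in> A" | "x \<in> B" "y \<in> B" | "x \<in> A \<and> y \<in> B \<or> x \<in> B \<and> y \<in> A"
          using xy by blast
        then show "glue g h x = 0"
        proof cases
          case 1 then show ?thesis using fillings_above[OF g _ xy(3) 1] xy(4) fA by simp
        next
          case 2 then show ?thesis using fillings_above[OF h _ xy(3) 2] xy(4) fB by simp
        next
          case 3
          have "0 \<in> V y" using mem[OF xy(2)] xy(4) by simp
          then have "V x \<subseteq> {0}" using indep[OF 3] xy(3) by blast
          then show ?thesis using mem[OF xy(1)] by blast
        qed
      next
        fix x y assume xy: "x \<in> A \<union> B" "y \<in> A \<union> B" "strictly_left x y" "glue g h y = 3"
        consider "x \<in> A" "y \<in> A" | "x \<in> B" "y \<in> B" | "x \<in> A \<and> y \<in> B \<or> x \<in> B \<and> y \<in> A"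
          using xy by blast
        then show "glue g h x = 3"
        proof cases
          case 1 then show ?thesis using fillings_left[OF g _ xy(3) 1] xy(4) fA by simp
        next
          case 2 then show ?thesis using fillings_left[OF h _ xy(3) 2] xy(4) fB by simp
        next
          case 3
          have "3 \<in> V y" using mem[OF xy(2)] xy(4) by simp
          then have "V x \<subseteq> {3}" using indep[OF 3] xy(3) by blast
          then show ?thesis using mem[OF xy(1)] by blast
        qed
      qed
    qed
  qed
  then show ?thesis by (simp add: bij_betw_same_card card_cartesian_product)
qed

text \<open>The parts share no row, so the only possible interaction is a zero in \<open>B\<close>
  forcing zeros above it in \<open>A\<close>, and \<open>B\<close> has no zeros.\<close>

lemma card_fillings_Un_below:
  assumes "\<And>x y. x \<in> A \<Longrightarrow> y \<in> B \<Longrightarrow> fst x < fst y" "\<And>y. y \<in> B \<Longrightarrow> 0 \<notin> V y"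
  shows "card (fillings (A \<union> B) V) = card (fillings A V) * card (fillings B V)"
proof (rule card_fillings_Un)
  show "A \<inter> B = {}" using assms(1) by blast
  fix x y assume xy: "x \<in> A \<and> y \<in> B \<or> x \<in> B \<and> y \<in> A"
  then have "\<not> strictly_left x y" "strictly_above x y \<Longrightarrow> y \<in> B"
    using assms(1)[of x y] assms(1)[of y x] by (auto simp: strictly_left_def strictly_above_def)
  then show "(strictly_above x y \<longrightarrow> 0 \<notin> V y \<or> V x \<subseteq> {0}) \<and> (strictly_left x y \<longrightarrow> 3 \<notin> V y \<or> V x \<subseteq> {3})"
    using assms(2) by blast
qed

text \<open>Transposed: the parts share no column, and without threes in \<open>A\<close> nothing is
  forced to its left in \<open>B\<close>.\<close>

lemma card_fillings_Un_left:
  assumes "\<And>x y. x \<in> A \<Longrightarrow> y \<in> B \<Longrightarrow> snd x < snd y" "\<And>x. x \<in> A \<Longrightarrow> 3 \<notin> V x"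
  shows "card (fillings (A \<union> B) V) = card (fillings A V) * card (fillings B V)"
proof (rule card_fillings_Un)
  show "A \<inter> B = {}" using assms(1) by blast
  fix x y assume xy: "x \<in> A \<and> y \<in> B \<or> x \<in> B \<and> y \<in> A"
  then have "\<not> strictly_above x y" "strictly_left x y \<Longrightarrow> y \<in> A"
    using assms(1)[of x y] assms(1)[of y x] by (auto simp: strictly_left_def strictly_above_def)
  then show "(strictly_above x y \<longrightarrow> 0 \<notin> V y \<or> V x \<subseteq> {0}) \<and> (strictly_left x y \<longrightarrow> 3 \<notin> V y \<or> V x \<subseteq> {3})"
    using assms(2) by blast
qed

lemma card_fillings_split:
  assumes "finite A" "\<And>y. y \<in> A \<Longrightarrow> finite (V y)" "x \<in> A"
  shows "card (fillings A V) =
    card (fillings A (V(x := V x \<inter> {v}))) + card (fillings A (V(x := V x - {v})))"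
proof -
  have "fillings A V = fillings A (V(x := V x \<inter> {v})) \<union> fillings A (V(x := V x - {v}))" (is "_ = ?F \<union> ?G")
  proof
    show "fillings A V \<subseteq> ?F \<union> ?G"
    proof
      fix f assume f: "f \<in> fillings A V"
      show "f \<in> ?F \<union> ?G"
      proof (cases "f x = v")
        case True
        then have "f \<in> ?F" by (intro fillings_restrict_values[OF f]) (use fillings_mem[OF f] in auto)
        then show ?thesis ..
      next
        case False
        then have "f \<in> ?G" by (intro fillings_restrict_values[OF f]) (use fillings_mem[OF f] in auto)
        then show ?thesis ..
      qed
    qed
    show "?F \<union> ?G \<subseteq> fillings A V"
      using fillings_mono[of A "V(x := V x \<inter> {v})" V] fillings_mono[of A "V(x := V x - {v})" V]
      by (auto split: if_splits)
  qed
  moreover have "?F \<inter> ?G = {}"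
  proof -
    have "f x = v" if "f \<in> ?F" for f using fillings_mem[OF that \<open>x \<in> A\<close>] by simp
    moreover have "f x \<noteq> v" if "f \<in> ?G" for f using fillings_mem[OF that \<open>x \<in> A\<close>] by simp
    ultimately show ?thesis by blast
  qed
  moreover have "finite ?F" "finite ?G"
    by (auto intro!: finite_fillings simp: assms split: if_splits)
  ultimately show ?thesis by (simp add: card_Un_disjoint)
qed

lemma card_fillings_single: "card (fillings {x} V) = card (V x)"
proof -
  have "fillings {x} V = Pi\<^sub>E {x} V"
    by (auto simp: fillings_def strictly_above_def strictly_left_def)
  then show ?thesis by (simp add: card_PiE)
qed

lemma card_fillings_forced:
  assumes "\<And>x. x \<in> A \<Longrightarrow> V x = {v}"
  shows "card (fillings A V) = 1"
proof -
  have "f \<in> fillings A V \<longleftrightarrow> f = (\<lambda>x\<in>A. v)" for f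
  proof
    assume "f \<in> fillings A V"
    then show "f = (\<lambda>x\<in>A. v)"
      using assms by (auto simp: fillings_def PiE_def Pi_def extensional_def fun_eq_iff)
  qed (auto simp: fillings_def assms)
  then have "fillings A V = {\<lambda>x\<in>A. v}" by blast
  then show ?thesis by simp
qed

text \<open>A zero in \<open>x\<close> forces zeros in all of \<open>A\<close>, giving one filling;
  any other value in \<open>x\<close> leaves \<open>A\<close> unconstrained.\<close>

lemma card_fillings_insert_below:
  assumes fin: "finite A" "\<And>y. y \<in> insert x A \<Longrightarrow> finite (V y)"
    and above: "\<And>y. y \<in> A \<Longrightarrow> strictly_above y x" and zero: "\<And>y. y \<in> A \<Longrightarrow> 0 \<in> V y"
  shows "card (fillings (insert x A) V) = of_bool (0 \<in> V x) + card (V x - {0}) * card (fillings A V)"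
proof -
  have x: "x \<notin> A" using above[of x] unfolding strictly_above_def by blast
  let ?V0 = "V(x := V x \<inter> {0})" and ?V1 = "V(x := V x - {0})"
  have "card (fillings (insert x A) ?V0) = of_bool (0 \<in> V x)"
  proof (cases "0 \<in> V x")
    case True
    have "fillings (insert x A) ?V0 = fillings (insert x A) (\<lambda>_. {0})"
    proof
      show "fillings (insert x A) ?V0 \<subseteq> fillings (insert x A) (\<lambda>_. {0})"
      proof
        fix f assume f: "f \<in> fillings (insert x A) ?V0"
        have "f x = 0" using fillings_mem[OF f, of x] by auto
        then show "f \<in> fillings (insert x A) (\<lambda>_. {0})"
          using fillings_above[OF f _ above] by (auto intro!: fillings_restrict_values[OF f])
      qed
      show "fillings (insert x A) (\<lambda>_. {0}) \<subseteq> fillings (insert x A) ?V0"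
        by (rule fillings_mono) (use zero True in auto)
    qed
    then show ?thesis using True by (simp add: card_fillings_forced[of _ _ 0])
  next
    case False
    have "fillings (insert x A) ?V0 = {}"
      using False fillings_mem[of _ "insert x A" ?V0 x] by auto
    then show ?thesis using False by simp
  qed
  moreover have "card (fillings (insert x A) ?V1) = card (V x - {0}) * card (fillings A V)"
  proof -
    have cross: "\<not> strictly_above x y" "\<not> strictly_left x y" "\<not> strictly_left y x" if "y \<in> A" for y
      using above[OF that] unfolding strictly_above_def strictly_left_def by auto
    have "card (fillings ({x} \<union> A) ?V1) = card (fillings {x} ?V1) * card (fillings A ?V1)"
      by (rule card_fillings_Un) (use x cross in auto)
    moreover have "fillings A ?V1 = fillings A V"
      by (rule fillings_cong) (use x in auto)
    ultimately show ?thesis by (simp add: card_fillings_single)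
  qed
  ultimately show ?thesis
    using card_fillings_split[of "insert x A" V x 0] fin by simp
qed

text \<open>The transpose of \<open>card_fillings_insert_below\<close>, with threes spreading to the
  left in place of zeros spreading upwards.\<close>

lemma card_fillings_insert_right:
  assumes fin: "finite A" "\<And>y. y \<in> insert x A \<Longrightarrow> finite (V y)"
    and left: "\<And>y. y \<in> A \<Longrightarrow> strictly_left y x" and three: "\<And>y. y \<in> A \<Longrightarrow> 3 \<in> V y"
  shows "card (fillings (insert x A) V) = of_bool (3 \<in> V x) + card (V x - {3}) * card (fillings A V)"
proof -
  have x: "x \<notin> A" using left[of x] unfolding strictly_left_def by blast
  let ?V0 = "V(x := V x \<inter> {3})" and ?V1 = "V(x := V x - {3})"
  have "card (fillings (insert x A) ?V0) = of_bool (3 \<in> V x)"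
  proof (cases "3 \<in> V x")
    case True
    have "fillings (insert x A) ?V0 = fillings (insert x A) (\<lambda>_. {3})"
    proof
      show "fillings (insert x A) ?V0 \<subseteq> fillings (insert x A) (\<lambda>_. {3})"
      proof
        fix f assume f: "f \<in> fillings (insert x A) ?V0"
        have "f x = 3" using fillings_mem[OF f, of x] by auto
        then show "f \<in> fillings (insert x A) (\<lambda>_. {3})"
          using fillings_left[OF f _ left] by (auto intro!: fillings_restrict_values[OF f])
      qed
      show "fillings (insert x A) (\<lambda>_. {3}) \<subseteq> fillings (insert x A) ?V0"
        by (rule fillings_mono) (use three True in auto)
    qed
    then show ?thesis using True by (simp add: card_fillings_forced[of _ _ 3])
  next
    case False
    have "fillings (insert x A) ?V0 = {}"
      using False fillings_mem[of _ "insert x A" ?V0 x] by auto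
    then show ?thesis using False by simp
  qed
  moreover have "card (fillings (insert x A) ?V1) = card (V x - {3}) * card (fillings A V)"
  proof -
    have cross: "\<not> strictly_left x y" "\<not> strictly_above x y" "\<not> strictly_above y x" if "y \<in> A" for y
      using left[OF that] unfolding strictly_above_def strictly_left_def by auto
    have "card (fillings ({x} \<union> A) ?V1) = card (fillings {x} ?V1) * card (fillings A ?V1)"
      by (rule card_fillings_Un) (use x cross in auto)
    moreover have "fillings A ?V1 = fillings A V"
      by (rule fillings_cong) (use x in auto)
    ultimately show ?thesis by (simp add: card_fillings_single)
  qed
  ultimately show ?thesis
    using card_fillings_split[of "insert x A" V x 3] fin by simp
qed

section \<open>Fillings of a single column or row\<close>

lemma card_fillings_column_Suc:
  assumes V: "\<And>r. 2 \<le> r \<Longrightarrow> r \<le> Suc h \<Longrightarrow> V (r, j) = {0, 1, 2}" and fin: "finite (V (Suc (Suc h), j))"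
  shows "card (fillings ({2..Suc (Suc h)} \<times> {j}) V) =
    of_bool (0 \<in> V (Suc (Suc h), j)) + card (V (Suc (Suc h), j) - {0}) * card (fillings ({2..Suc h} \<times> {j}) V)"
proof -
  have eq: "{2..Suc (Suc h)} \<times> {j} = insert (Suc (Suc h), j) ({2..Suc h} \<times> {j})" by auto
  have V': "V y = {0, 1, 2}" if "y \<in> {2..Suc h} \<times> {j}" for y
    using V that by (cases y) simp
  show ?thesis
    unfolding eq by (rule card_fillings_insert_below) (use V' fin in \<open>auto simp: strictly_above_def\<close>)
qed

text \<open>With c_h fillings of h cells, c_0 = 1 and c_(h+1) = 1 + 2 c_h. In
  \<open>card_fillings_column_Suc\<close> the values of the last cell are left open because that
  cell may lie on the border.\<close>

lemma card_fillings_column: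
  assumes "\<And>r. 2 \<le> r \<Longrightarrow> r \<le> Suc h \<Longrightarrow> V (r, j) = {0, 1, 2}"
  shows "int (card (fillings ({2..Suc h} \<times> {j}) V)) = 2 ^ Suc h - 1"
  using assms
proof (induction h)
  case (Suc h)
  have V: "V (Suc (Suc h), j) = {0, 1, 2}" by (rule Suc.prems) auto
  have "int (card (fillings ({2..Suc h} \<times> {j}) V)) = 2 ^ Suc h - 1"
    by (rule Suc.IH) (rule Suc.prems, simp_all)
  then show ?case
    by (subst card_fillings_column_Suc) (simp_all add: V Suc.prems)
qed simp

lemma card_fillings_row_Suc:
  assumes V: "\<And>j. l < j \<Longrightarrow> j < n \<Longrightarrow> V (r, j) = {1, 2, 3}" and fin: "finite (V (r, l))" and l: "l < n"
  shows "card (fillings ({r} \<times> {l..<n}) V) =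
    of_bool (3 \<in> V (r, l)) + card (V (r, l) - {3}) * card (fillings ({r} \<times> {Suc l..<n}) V)"
proof -
  have eq: "{r} \<times> {l..<n} = insert (r, l) ({r} \<times> {Suc l..<n})" using l by auto
  have V': "V y = {1, 2, 3}" if "y \<in> {r} \<times> {Suc l..<n}" for y
    using V that by (cases y) simp
  show ?thesis
    unfolding eq by (rule card_fillings_insert_right) (use V' fin in \<open>auto simp: strictly_left_def\<close>)
qed

text \<open>The same recursion as for columns, with cells added on the right, that is, with
  decreasing label \<open>l\<close>.\<close>

lemma card_fillings_row:
  assumes "l \<le> n" "\<And>j. l \<le> j \<Longrightarrow> j < n \<Longrightarrow> V (r, j) = {1, 2, 3}"
  shows "int (card (fillings ({r} \<times> {l..<n}) V)) = 2 ^ Suc (n - l) - 1"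
  using assms
proof (induction l rule: inc_induct)
  case (step l)
  have V: "V (r, l) = {1, 2, 3}" by (rule step.prems) (use step.hyps in auto)
  have IH: "int (card (fillings ({r} \<times> {Suc l..<n}) V)) = 2 ^ Suc (n - Suc l) - 1"
    by (rule step.IH) (rule step.prems, simp_all)
  have "card (fillings ({r} \<times> {l..<n}) V) = 1 + 2 * card (fillings ({r} \<times> {Suc l..<n}) V)"
    by (subst card_fillings_row_Suc) (simp_all add: V step.prems step.hyps)
  moreover have "n - l = Suc (n - Suc l)" using step.hyps by simp
  ultimately show ?case using IH by simp
qed simp

section \<open>Regions with constant border\<close>

text \<open>What remains of the staircase above a constant row \<open>t + 1\<close> and to the left
  of a constant column \<open>i\<close>.\<close>

definition region :: "nat \<Rightarrow> nat \<Rightarrow> nat \<Rightarrow> cell set" where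
  "region n i t = {(r, j). 2 \<le> r \<and> r \<le> t \<and> i < j \<and> j < n \<and> r \<le> Suc j}"

text \<open>By the choice of the constant column and row, border cells of the region carry neither
  \<open>0\<close> nor \<open>3\<close>; being nonempty they are not \<open>1\<close>
  either.\<close>

definition free_border_values :: "cell \<Rightarrow> nat set" where
  "free_border_values x = (if fst x = Suc (snd x) then {2} else {0, 1, 2, 3})"

text \<open>
  The value is \<open>g(i, t - 1 - i, n - t)\<close> if \<open>i < t\<close>; if \<open>t - 1 \<le> i\<close>, the region is a rectangle with \<open>t - 1\<close>
  rows and \<open>n - 1 - i\<close> columns and the value is \<open>g(t - 1, 0, n - 1 - i)\<close>.
\<close>

definition region_count :: "nat \<Rightarrow> nat \<Rightarrow> nat \<Rightarrow> nat" where
  "region_count n i t = card (fillings (region n i t) free_border_values)"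

section \<open>Inclusion-exclusion and the recurrences for regions\<close>

lemma finite_region: "finite (region n i t)"
  by (rule finite_subset[of _ "{..t} \<times> {..n}"]) (auto simp: region_def)

lemma finite_free_border_values: "finite (free_border_values x)"
  by (simp add: free_border_values_def)

text \<open>Inclusion-exclusion over the fillings with no three in the rightmost column
  \<open>K\<close> and those with no zero in the bottom row \<open>L\<close>. In either case, and in
  both together, the restricted cells decouple from the rest, which is again a region. The factors
  for \<open>K\<close>, \<open>L\<close> and \<open>K \<union> L\<close> depend on how the corner
  \<open>(t + 1, i + 1)\<close> lies relative to the border and are evaluated case by case
  below.\<close>

lemma region_count_rec:
  fixes n i t
  defines "K \<equiv> {x \<in> region n i (Suc t). snd x = Suc i}"
    and "L \<equiv> {x \<in> region n i (Suc t). fst x = Suc t}"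
    and "VK \<equiv> \<lambda>x. free_border_values x - (if snd x = Suc i then {3} else {})"
    and "VL \<equiv> \<lambda>x. free_border_values x - (if fst x = Suc t then {0} else {})"
    and "VKL \<equiv> \<lambda>x. free_border_values x - (if snd x = Suc i then {3} else {}) - (if fst x = Suc t then {0} else {})"
  shows "int (region_count n i (Suc t)) =
    int (card (fillings K VK)) * int (region_count n (Suc i) (Suc t)) +
    int (card (fillings L VL)) * int (region_count n i t) -
    int (card (fillings (K \<union> L) VKL)) * int (region_count n (Suc i) t)"
proof -
  let ?R = "region n i (Suc t)" and ?V = free_border_values
  have sub: "fillings ?R VK \<subseteq> fillings ?R ?V" "fillings ?R VL \<subseteq> fillings ?R ?V"
    by (rule fillings_mono, simp add: VK_def VL_def)+
  have "fillings ?R ?V \<subseteq> fillings ?R VK \<union> fillings ?R VL"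
  proof
    fix f assume f: "f \<in> fillings ?R ?V"
    note V = fillings_mem[OF f]
    show "f \<in> fillings ?R VK \<union> fillings ?R VL"
    proof (cases "\<exists>x\<in>K. f x = 3")
      case False
      then have "f \<in> fillings ?R VK"
        by (intro fillings_restrict_values[OF f]) (use V in \<open>auto simp: VK_def K_def\<close>)
      then show ?thesis ..
    next
      case True
      then obtain r where r: "(r, Suc i) \<in> ?R" "f (r, Suc i) = 3" by (auto simp: K_def)
      have "r \<noteq> Suc (Suc i)" using V[OF r(1)] r(2) by (auto simp: free_border_values_def)
      have "f (Suc t, j) \<noteq> 0" if j: "(Suc t, j) \<in> ?R" for j
      proof
        assume zero: "f (Suc t, j) = 0"
        \<comment> \<open>The row of the three and the column of the zero cross in
          \<open>(r, j)\<close>.\<close>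
        have mem: "(r, j) \<in> ?R" using r(1) j by (auto simp: region_def)
        have "f (r, j) = 3"
          using fillings_left[OF f r(2) _ mem r(1)] r j
          by (cases "j = Suc i") (auto simp: strictly_left_def region_def)
        moreover have "f (r, j) = 0"
          using fillings_above[OF f zero _ mem j] zero r
          by (cases "r = Suc t") (auto simp: strictly_above_def region_def)
        ultimately show False by simp
      qed
      then have "f \<in> fillings ?R VL"
        by (intro fillings_restrict_values[OF f]) (use V in \<open>auto simp: VL_def\<close>)
      then show ?thesis ..
    qed
  qed
  then have Un: "fillings ?R ?V = fillings ?R VK \<union> fillings ?R VL" using sub by blast
  have Int: "fillings ?R VK \<inter> fillings ?R VL = fillings ?R VKL"
  proof
    show "fillings ?R VK \<inter> fillings ?R VL \<subseteq> fillings ?R VKL"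
    proof
      fix f assume "f \<in> fillings ?R VK \<inter> fillings ?R VL"
      then have f: "f \<in> fillings ?R VK" "f \<in> fillings ?R VL" by auto
      have "f x \<in> VKL x" if "x \<in> ?R" for x
        using fillings_mem[OF f(1) that] fillings_mem[OF f(2) that] by (simp add: VK_def VL_def VKL_def)
      then show "f \<in> fillings ?R VKL" by (rule fillings_restrict_values[OF f(1)])
    qed
    show "fillings ?R VKL \<subseteq> fillings ?R VK \<inter> fillings ?R VL"
      by (intro Int_greatest fillings_mono) (auto simp: VK_def VL_def VKL_def)
  qed
  have fin: "finite (fillings ?R VK)" "finite (fillings ?R VL)"
    by (auto intro!: finite_fillings finite_region simp: VK_def VL_def finite_free_border_values)
  have K: "card (fillings ?R VK) = card (fillings K VK) * region_count n (Suc i) (Suc t)"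
  proof -
    have "?R = K \<union> region n (Suc i) (Suc t)" by (auto simp: K_def region_def)
    moreover have "card (fillings (K \<union> region n (Suc i) (Suc t)) VK) =
        card (fillings K VK) * card (fillings (region n (Suc i) (Suc t)) VK)"
      by (rule card_fillings_Un_left) (auto simp: K_def region_def VK_def)
    moreover have "fillings (region n (Suc i) (Suc t)) VK = fillings (region n (Suc i) (Suc t)) ?V"
      by (rule fillings_cong) (auto simp: VK_def region_def)
    ultimately show ?thesis by (simp add: region_count_def)
  qed
  have L: "card (fillings ?R VL) = card (fillings L VL) * region_count n i t"
  proof -
    have "?R = region n i t \<union> L" by (auto simp: L_def region_def)
    moreover have "card (fillings (region n i t \<union> L) VL) =
        card (fillings (region n i t) VL) * card (fillings L VL)"
      by (rule card_fillings_Un_below) (auto simp: L_def region_def VL_def)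
    moreover have "fillings (region n i t) VL = fillings (region n i t) ?V"
      by (rule fillings_cong) (auto simp: VL_def region_def)
    ultimately show ?thesis by (simp add: region_count_def)
  qed
  have KL: "card (fillings ?R VKL) = card (fillings (K \<union> L) VKL) * region_count n (Suc i) t"
  proof -
    have "?R = (K \<union> L) \<union> region n (Suc i) t" by (auto simp: L_def K_def region_def)
    \<comment> \<open>\<open>K\<close> lies to the right of the remaining region and
      \<open>L\<close> below it; lacking threes and zeros respectively, they force nothing
      there.\<close>
    moreover have "card (fillings ((K \<union> L) \<union> region n (Suc i) t) VKL) =
        card (fillings (K \<union> L) VKL) * card (fillings (region n (Suc i) t) VKL)"
      by (rule card_fillings_Un)
        (auto simp: K_def L_def region_def strictly_above_def strictly_left_def VKL_def)
    moreover have "fillings (region n (Suc i) t) VKL = fillings (region n (Suc i) t) ?V"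
      by (rule fillings_cong) (auto simp: VKL_def region_def)
    ultimately show ?thesis by (simp add: region_count_def)
  qed
  have "card (fillings ?R VK) + card (fillings ?R VL) = region_count n i (Suc t) + card (fillings ?R VKL)"
    using card_Un_Int[OF fin] by (simp add: Un[symmetric] Int region_count_def)
  then show ?thesis unfolding K L KL
    by (simp flip: of_nat_mult of_nat_add)
qed

text \<open>The column and the row share their corner. A corner value \<open>1\<close> or
  \<open>2\<close> forces nothing, so the \<open>h\<close> cells above it, the
  \<open>n - l - 1\<close> cells to its left and the corner itself are independent.\<close>

lemma card_fillings_col_row_corner:
  assumes V: "\<And>r. 2 \<le> r \<Longrightarrow> r \<le> Suc h \<Longrightarrow> V (r, l) = {0, 1, 2}"
      "\<And>j. l < j \<Longrightarrow> j < n \<Longrightarrow> V (Suc (Suc h), j) = {1, 2, 3}"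
      "V (Suc (Suc h), l) \<subseteq> {1, 2}" and l: "l < n"
  shows "int (card (fillings ({2..Suc (Suc h)} \<times> {l} \<union> {Suc (Suc h)} \<times> {l..<n}) V)) =
    (2 ^ Suc h - 1) * int (card (V (Suc (Suc h), l))) * (2 ^ (n - l) - 1)"
proof -
  let ?c = "(Suc (Suc h), l)" and ?A = "{2..Suc h} \<times> {l}" and ?B = "{Suc (Suc h)} \<times> {Suc l..<n}"
  have VA: "V x = {0, 1, 2}" if "x \<in> ?A" for x using V(1) that by (cases x) simp
  have VB: "V x = {1, 2, 3}" if "x \<in> ?B" for x using V(2) that by (cases x) simp
  have Vc: "0 \<notin> V ?c" "3 \<notin> V ?c" using V(3) by auto
  have "{2..Suc (Suc h)} \<times> {l} \<union> {Suc (Suc h)} \<times> {l..<n} = ?A \<union> ({?c} \<union> ?B)"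
    using l by auto
  moreover have "card (fillings (?A \<union> ({?c} \<union> ?B)) V) = card (fillings ?A V) * card (fillings ({?c} \<union> ?B) V)"
    by (rule card_fillings_Un) (use Vc in \<open>auto simp: VA VB strictly_above_def strictly_left_def\<close>)
  moreover have "card (fillings ({?c} \<union> ?B) V) = card (fillings {?c} V) * card (fillings ?B V)"
    by (rule card_fillings_Un) (use Vc in \<open>auto simp: VA VB strictly_above_def strictly_left_def\<close>)
  moreover have "int (card (fillings ?A V)) = 2 ^ Suc h - 1"
    by (rule card_fillings_column) (rule V(1))
  moreover have "int (card (fillings ?B V)) = 2 ^ Suc (n - Suc l) - 1"
    by (rule card_fillings_row) (use l V(2) in auto)
  moreover have "Suc (n - Suc l) = n - l" using l by simp
  ultimately show ?thesis by (simp add: card_fillings_single)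
qed

text \<open>The recurrence for \<open>j = 0\<close>. Since \<open>t + 1 <= i\<close>, the corner
  \<open>(t + 2, i + 1)\<close> is not a border cell; it keeps the values \<open>1\<close> and
  \<open>2\<close> once \<open>0\<close> and \<open>3\<close> are excluded, which accounts for the
  factor \<open>2\<close>.\<close>

lemma region_count_rec_rectangle:
  assumes "Suc t \<le> i" "Suc i < n"
  shows "int (region_count n i (Suc (Suc t))) =
    (2 ^ Suc (Suc t) - 1) * int (region_count n (Suc i) (Suc (Suc t))) +
    (2 ^ (n - i) - 1) * int (region_count n i (Suc t)) -
    2 * (2 ^ Suc t - 1) * (2 ^ (n - Suc i) - 1) * int (region_count n (Suc i) (Suc t))"
proof -
  have K: "{x \<in> region n i (Suc (Suc t)). snd x = Suc i} = {2..Suc (Suc t)} \<times> {Suc i}"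
    and L: "{x \<in> region n i (Suc (Suc t)). fst x = Suc (Suc t)} = {Suc (Suc t)} \<times> {Suc i..<n}"
    using assms by (auto simp: region_def)
  have "int (card (fillings ({2..Suc (Suc t)} \<times> {Suc i})
      (\<lambda>x. free_border_values x - (if snd x = Suc i then {3} else {})))) = 2 ^ Suc (Suc t) - 1"
    by (rule card_fillings_column) (use assms in \<open>auto simp: free_border_values_def\<close>)
  moreover have "int (card (fillings ({Suc (Suc t)} \<times> {Suc i..<n})
      (\<lambda>x. free_border_values x - (if fst x = Suc (Suc t) then {0} else {})))) = 2 ^ Suc (n - Suc i) - 1"
    by (rule card_fillings_row) (use assms in \<open>auto simp: free_border_values_def\<close>)
  moreover have "int (card (fillings ({2..Suc (Suc t)} \<times> {Suc i} \<union> {Suc (Suc t)} \<times> {Suc i..<n})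
      (\<lambda>x. free_border_values x - (if snd x = Suc i then {3} else {}) - (if fst x = Suc (Suc t) then {0} else {}))))
      = (2 ^ Suc t - 1) * int (card {1, 2::nat}) * (2 ^ (n - Suc i) - 1)"
  proof (subst card_fillings_col_row_corner)
    have eq: "free_border_values (Suc (Suc t), Suc i) - {3} - {0} = {1, 2}"
      using assms by (auto simp: free_border_values_def)
    show "(2 ^ Suc t - 1) * int (card (free_border_values (Suc (Suc t), Suc i) -
        (if snd (Suc (Suc t), Suc i) = Suc i then {3} else {}) -
        (if fst (Suc (Suc t), Suc i) = Suc (Suc t) then {0} else {}))) * (2 ^ (n - Suc i) - 1)
      = (2 ^ Suc t - 1) * int (card {1, 2::nat}) * (2 ^ (n - Suc i) - 1)"
      by (simp add: eq)
  qed (use assms in \<open>auto simp: free_border_values_def\<close>)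
  moreover have "Suc (n - Suc i) = n - i" using assms by simp
  ultimately show ?thesis
    unfolding region_count_rec[of n i "Suc t"] K L by simp
qed

text \<open>The recurrence for \<open>j = 1\<close>. The corner \<open>(i + 2, i + 1)\<close> is a
  border cell fixed to \<open>2\<close>; it contributes a factor \<open>1\<close>, and the exponents
  for the column and the row are one less than they would be with an ordinary corner.\<close>

lemma region_count_rec_corner:
  assumes "Suc i < n"
  shows "int (region_count n i (Suc (Suc i))) =
    (2 ^ Suc i - 1) * int (region_count n (Suc i) (Suc (Suc i))) +
    (2 ^ (n - Suc i) - 1) * int (region_count n i (Suc i)) -
    (2 ^ Suc i - 1) * (2 ^ (n - Suc i) - 1) * int (region_count n (Suc i) (Suc i))"
proof -
  have K: "{x \<in> region n i (Suc (Suc i)). snd x = Suc i} = {2..Suc (Suc i)} \<times> {Suc i}"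
    and L: "{x \<in> region n i (Suc (Suc i)). fst x = Suc (Suc i)} = {Suc (Suc i)} \<times> {Suc i..<n}"
    using assms by (auto simp: region_def)
  have n: "Suc (n - Suc (Suc i)) = n - Suc i" using assms by simp
  let ?VK = "\<lambda>x. free_border_values x - (if snd x = Suc i then {3} else {})"
  let ?VL = "\<lambda>x. free_border_values x - (if fst x = Suc (Suc i) then {0} else {})"
  have "int (card (fillings ({2..Suc i} \<times> {Suc i}) ?VK)) = 2 ^ Suc i - 1"
    by (rule card_fillings_column) (auto simp: free_border_values_def)
  then have "int (card (fillings ({2..Suc (Suc i)} \<times> {Suc i}) ?VK)) = 2 ^ Suc i - 1"
    by (subst card_fillings_column_Suc) (auto simp: free_border_values_def)
  moreover have "int (card (fillings ({Suc (Suc i)} \<times> {Suc (Suc i)..<n}) ?VL)) = 2 ^ (n - Suc i) - 1"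
    unfolding n[symmetric] by (rule card_fillings_row) (use assms in \<open>auto simp: free_border_values_def\<close>)
  then have "int (card (fillings ({Suc (Suc i)} \<times> {Suc i..<n}) ?VL)) = 2 ^ (n - Suc i) - 1"
    by (subst card_fillings_row_Suc) (use assms in \<open>auto simp: free_border_values_def\<close>)
  moreover have "int (card (fillings ({2..Suc (Suc i)} \<times> {Suc i} \<union> {Suc (Suc i)} \<times> {Suc i..<n})
      (\<lambda>x. free_border_values x - (if snd x = Suc i then {3} else {}) - (if fst x = Suc (Suc i) then {0} else {}))))
      = (2 ^ Suc i - 1) * (2 ^ (n - Suc i) - 1)"
    by (subst card_fillings_col_row_corner) (use assms in \<open>auto simp: free_border_values_def\<close>)
  ultimately show ?thesis
    unfolding region_count_rec[of n i "Suc i"] K L by simp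
qed

text \<open>The recurrence for \<open>j > 1\<close>. The column ends at the border cell
  \<open>(i + 2, i + 1)\<close> and the row at \<open>(t + 1, t)\<close>. As
  \<open>i + 2 <= t\<close>, they have no row or column in common, so the mixed term is a plain
  product.\<close>

lemma region_count_rec_stair:
  assumes "Suc (Suc i) \<le> t" "t < n"
  shows "int (region_count n i (Suc t)) =
    (2 ^ Suc i - 1) * int (region_count n (Suc i) (Suc t)) +
    (2 ^ (n - t) - 1) * int (region_count n i t) -
    (2 ^ Suc i - 1) * (2 ^ (n - t) - 1) * int (region_count n (Suc i) t)"
proof -
  have K: "{x \<in> region n i (Suc t). snd x = Suc i} = {2..Suc (Suc i)} \<times> {Suc i}" (is "_ = ?K")
    and L: "{x \<in> region n i (Suc t). fst x = Suc t} = {Suc t} \<times> {t..<n}" (is "_ = ?L")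
    using assms by (auto simp: region_def)
  have n: "Suc (n - Suc t) = n - t" using assms by simp
  have cK: "int (card (fillings ?K V)) = 2 ^ Suc i - 1"
    if V: "\<And>x. x \<in> ?K \<Longrightarrow> V x = free_border_values x - {3}" for V
  proof -
    have "int (card (fillings ({2..Suc i} \<times> {Suc i}) V)) = 2 ^ Suc i - 1"
      by (rule card_fillings_column) (auto simp: V free_border_values_def)
    then show ?thesis
      by (subst card_fillings_column_Suc) (auto simp: V free_border_values_def)
  qed
  have cL: "int (card (fillings ?L V)) = 2 ^ (n - t) - 1"
    if V: "\<And>x. x \<in> ?L \<Longrightarrow> V x = free_border_values x - {0}" for V
  proof -
    have "int (card (fillings ({Suc t} \<times> {Suc t..<n}) V)) = 2 ^ (n - t) - 1"
      unfolding n[symmetric]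
      by (rule card_fillings_row) (use assms in \<open>auto simp: V free_border_values_def\<close>)
    then show ?thesis
      by (subst card_fillings_row_Suc) (use assms in \<open>auto simp: V free_border_values_def\<close>)
  qed
  let ?V = "\<lambda>x. free_border_values x - (if snd x = Suc i then {3} else {}) - (if fst x = Suc t then {0} else {})"
  have "card (fillings (?K \<union> ?L) ?V) = card (fillings ?K ?V) * card (fillings ?L ?V)"
    by (rule card_fillings_Un) (use assms in \<open>auto simp: strictly_above_def strictly_left_def\<close>)
  moreover have "int (card (fillings ?K ?V)) = 2 ^ Suc i - 1"
    by (rule cK) (use assms in auto)
  moreover have "int (card (fillings ?L ?V)) = 2 ^ (n - t) - 1"
    by (rule cL) (use assms in auto)
  moreover have "int (card (fillings ?K (\<lambda>x. free_border_values x - (if snd x = Suc i then {3} else {})))) = 2 ^ Suc i - 1"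
    by (rule cK) auto
  moreover have "int (card (fillings ?L (\<lambda>x. free_border_values x - (if fst x = Suc t then {0} else {})))) = 2 ^ (n - t) - 1"
    by (rule cL) auto
  ultimately show ?thesis
    unfolding region_count_rec[of n i t] K L by simp
qed

lemma region_count_empty:
  assumes "t \<le> 1 \<or> n \<le> Suc i"
  shows "region_count n i t = 1"
proof -
  have "region n i t = {}" using assms by (auto simp: region_def)
  then show ?thesis by (simp add: region_count_def)
qed

text \<open>The region is a rectangle with \<open>a\<close> rows and \<open>b\<close> columns and no
  border cell, and only its size matters. Removing the rightmost column raises \<open>i\<close> and
  lowers \<open>b\<close> while \<open>Suc (i + b)\<close> stays fixed, so the induction lets
  \<open>i\<close> vary.\<close>

lemma region_count_rectangle:
  assumes "a \<le> i"
  shows "int (region_count (Suc (i + b)) i (Suc a)) = spine_g a 0 b"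
  using assms
proof (induction "a + b" arbitrary: a b i rule: less_induct)
  case less
  show ?case
  proof (cases "a = 0 \<or> b = 0")
    case True
    then show ?thesis by (cases b) (auto simp: region_count_empty)
  next
    case False
    then obtain a' b' where ab: "a = Suc a'" "b = Suc b'" by (auto simp: gr0_conv_Suc)
    have "int (region_count (Suc (i + b)) (Suc i) (Suc (Suc a'))) = spine_g a 0 b'"
      using less.hyps[of a b' "Suc i"] less.prems ab by simp
    moreover have "int (region_count (Suc (i + b)) i (Suc a')) = spine_g a' 0 b"
      using less.hyps[of a' b i] less.prems ab by simp
    moreover have "int (region_count (Suc (i + b)) (Suc i) (Suc a')) = spine_g a' 0 b'"
      using less.hyps[of a' b' "Suc i"] less.prems ab by simp
    ultimately show ?thesis
      using region_count_rec_rectangle[of a' i "Suc (i + b)"] less.prems ab by simp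
  qed
qed

text \<open>Removing the rightmost column turns \<open>(a, j, b)\<close> into
  \<open>(a + 1, j - 1, b)\<close>, removing the bottom row gives \<open>(a, j - 1, b + 1)\<close>,
  and removing both gives \<open>(a + 1, j - 2, b + 1)\<close>; for \<open>j = 1\<close> the last is
  a rectangle with \<open>a\<close> rows and \<open>b\<close> columns.\<close>

lemma region_count_stair:
  "int (region_count (Suc (a + j + b)) a (Suc (a + j))) = spine_g a j b"
proof (induction j arbitrary: a b rule: less_induct)
  case (less j)
  consider "j = 0" | "j = 1" | j' where "j = Suc (Suc j')"
    by (metis One_nat_def not0_implies_Suc)
  then show ?case
  proof cases
    case 1
    then show ?thesis using region_count_rectangle[of a a b] by simp
  next
    case 2
    then show ?thesis
      using region_count_rec_corner[of a "Suc (a + j + b)"] region_count_rectangle[of "Suc a" "Suc a" b]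
        region_count_rectangle[of a a "Suc b"] region_count_rectangle[of a "Suc a" b]
      by simp
  next
    case 3
    then show ?thesis
      using region_count_rec_stair[of a "a + j" "Suc (a + j + b)"] less[of "Suc j'" "Suc a" b]
        less[of "Suc j'" a "Suc b"] less[of j' "Suc a" "Suc b"]
      by simp
  qed
qed

section \<open>Fillings of the staircase\<close>

definition inner :: "nat \<Rightarrow> cell set" where
  "inner n = {(r, j). 2 \<le> r \<and> r \<le> Suc j \<and> j < n}"

definition lower :: "nat \<Rightarrow> nat \<Rightarrow> cell set" where
  "lower n s = {(r, j). s < r \<and> r \<le> Suc j \<and> j < n}"

text \<open>State \<open>1\<close> means an empty free cell, and border cells are never
  empty.\<close>

definition state_values :: "cell \<Rightarrow> nat set" where
  "state_values x = (if fst x = Suc (snd x) then {0, 2, 3} else {0, 1, 2, 3})"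

section \<open>Classes of fillings by their constant column and row\<close>

text \<open>
  The fillings in which \<open>i\<close> is the leftmost column with border entry \<open>0\<close> (\<open>i = 0\<close> if there is none) and \<open>t + 1\<close>
  the topmost row with border entry \<open>3\<close> (\<open>t = n\<close> if there is none).
\<close>

definition class_values :: "nat \<Rightarrow> nat \<Rightarrow> cell \<Rightarrow> nat set" where
  "class_values i t x =
    (if snd x < i then state_values x - {3}
     else if snd x = i then {0}
     else if fst x \<le> t then free_border_values x
     else if fst x = Suc t then {3}
     else state_values x - {0})"

lemma finite_inner: "finite (inner n)"
  by (rule finite_subset[of _ "{..n} \<times> {..n}"]) (auto simp: inner_def)

text \<open>Without threes the columns are independent. Column \<open>j\<close> has \<open>j\<close>
  cells, the lowest being a border cell with values \<open>0\<close> and \<open>2\<close>, hence 1 +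
  (2^j - 1) = 2^j fillings; the labels 1, ..., n - 1 add up in the exponent.\<close>

lemma card_fillings_inner:
  assumes "\<And>x. x \<in> inner n \<Longrightarrow> V x = state_values x - {3}"
  shows "card (fillings (inner n) V) = 2 ^ (n * (n - 1) div 2)"
  using assms
proof (induction n)
  case 0
  then show ?case by (simp add: inner_def)
next
  case (Suc n)
  let ?C = "{2..Suc n} \<times> {n}"
  have split: "inner (Suc n) = inner n \<union> ?C"
    by (auto simp: inner_def)
  have V: "V x = state_values x - {3}" if "x \<in> inner n \<or> x \<in> ?C" for x
    using that by (intro Suc.prems) (auto simp: split)
  have "card (fillings (inner n \<union> ?C) V) = card (fillings (inner n) V) * card (fillings ?C V)"
  proof (rule card_fillings_Un_left)
    show "3 \<notin> V x" if "x \<in> inner n" for x using V[of x] that by simp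
  qed (auto simp: inner_def)
  moreover have "card (fillings (inner n) V) = 2 ^ (n * (n - 1) div 2)"
    by (rule Suc.IH) (simp add: V)
  moreover have "int (card (fillings ?C V)) = 2 ^ n"
  proof (cases n)
    case (Suc h)
    have "int (card (fillings ({2..Suc h} \<times> {n}) V)) = 2 ^ Suc h - 1"
      by (rule card_fillings_column) (simp add: V Suc state_values_def insert_commute insert_Diff_if)
    moreover have "card (fillings ({2..Suc (Suc h)} \<times> {n}) V) =
        of_bool (0 \<in> V (Suc (Suc h), n)) + card (V (Suc (Suc h), n) - {0}) * card (fillings ({2..Suc h} \<times> {n}) V)"
      by (rule card_fillings_column_Suc) (simp_all add: V Suc state_values_def insert_Diff_if)
    moreover have "V (Suc (Suc h), n) = {0, 2}"
      by (simp add: V Suc state_values_def insert_Diff_if)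
    ultimately show ?thesis by (simp add: Suc insert_Diff_if)
  qed simp
  then have "int (card (fillings ?C V)) = int (2 ^ n)" by simp
  then have "card (fillings ?C V) = 2 ^ n" by (rule of_nat_eq_iff[THEN iffD1])
  moreover have "Suc n * (Suc n - 1) div 2 = n * (n - 1) div 2 + n"
    by (cases n) auto
  ultimately show ?case unfolding split by (simp add: power_add)
qed

text \<open>Without zeros the rows are independent, and row \<open>s + 1\<close> with its
  \<open>n - s\<close> cells has \<open>2 ^ (n - s)\<close> fillings by the transposed
  count.\<close>

lemma card_fillings_lower:
  assumes "s \<le> n" "\<And>x. x \<in> lower n s \<Longrightarrow> V x = state_values x - {0}"
  shows "card (fillings (lower n s) V) = 2 ^ (Suc (n - s) * (n - s) div 2)"
  using assms
proof (induction s rule: inc_induct)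
  case base
  have "lower n n = {}" by (auto simp: lower_def)
  then show ?case by simp
next
  case (step s)
  let ?R = "{Suc s} \<times> {s..<n}"
  have split: "lower n s = ?R \<union> lower n (Suc s)"
    by (auto simp: lower_def)
  have V: "V x = state_values x - {0}" if "x \<in> lower n (Suc s) \<or> x \<in> ?R" for x
    using that by (intro step.prems) (auto simp: split)
  have "card (fillings (?R \<union> lower n (Suc s)) V) = card (fillings ?R V) * card (fillings (lower n (Suc s)) V)"
  proof (rule card_fillings_Un_below)
    show "0 \<notin> V x" if "x \<in> lower n (Suc s)" for x using V[of x] that by simp
  qed (auto simp: lower_def)
  moreover have "card (fillings (lower n (Suc s)) V) = 2 ^ (Suc (n - Suc s) * (n - Suc s) div 2)"
    by (rule step.IH) (simp add: V)
  moreover have "int (card (fillings ?R V)) = 2 ^ (n - s)"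
  proof -
    have n: "Suc (n - Suc s) = n - s" using step.hyps by simp
    have "int (card (fillings ({Suc s} \<times> {Suc s..<n}) V)) = 2 ^ (n - s) - 1"
      unfolding n[symmetric]
      by (rule card_fillings_row) (use step.hyps in \<open>simp_all add: V state_values_def insert_Diff_if\<close>)
    moreover have "card (fillings ?R V) =
        of_bool (3 \<in> V (Suc s, s)) + card (V (Suc s, s) - {3}) * card (fillings ({Suc s} \<times> {Suc s..<n}) V)"
      by (rule card_fillings_row_Suc) (use step.hyps in \<open>simp_all add: V state_values_def insert_Diff_if\<close>)
    moreover have "V (Suc s, s) = {2, 3}"
      using step.hyps by (simp add: V state_values_def insert_Diff_if)
    ultimately show ?thesis by (simp add: insert_Diff_if)
  qed
  then have "int (card (fillings ?R V)) = int (2 ^ (n - s))" by simp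
  then have "card (fillings ?R V) = 2 ^ (n - s)" by (rule of_nat_eq_iff[THEN iffD1])
  moreover have "Suc (n - s) * (n - s) div 2 = (n - s) + Suc (n - Suc s) * (n - Suc s) div 2"
  proof -
    obtain d where "n - s = Suc d" "n - Suc s = d" using step.hyps by (metis Suc_diff_Suc)
    then show ?thesis by simp
  qed
  ultimately show ?case unfolding split by (simp add: power_add)
qed

text \<open>The column of zeros separates off a triangle to its right, where no threes occur, and
  the row of threes a triangle below it, where no zeros occur. The constant column and row have one
  filling each.\<close>

lemma card_fillings_class:
  assumes "i < t" "t \<le> n"
  shows "card (fillings (inner n) (class_values i t)) =
    2 ^ (i * (i - 1) div 2) * region_count n i t * 2 ^ ((n - t) * (n - t - 1) div 2)"
proof -
  let ?V = "class_values i t" and ?C = "{2..Suc i} \<times> {i}"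
  \<comment> \<open>For \<open>i = 0\<close> the pieces \<open>inner i\<close> and \<open>?C\<close>
    are empty.\<close>
  have "inner n = (inner i \<union> ({x \<in> ?C. i < n})) \<union> region n i t \<union> lower n t"
    using assms by (auto simp: inner_def lower_def region_def)
  moreover have "{x \<in> ?C. i < n} = ?C" using assms by auto
  ultimately have split: "inner n = ((inner i \<union> ?C) \<union> region n i t) \<union> lower n t" by simp
  have no3: "3 \<notin> ?V x" if "snd x \<le> i" for x
    using that by (simp add: class_values_def)
  have no0: "0 \<notin> ?V x" if "t < fst x" "i < snd x" for x
    using that by (simp add: class_values_def)
  have "card (fillings (((inner i \<union> ?C) \<union> region n i t) \<union> lower n t) ?V)
      = card (fillings ((inner i \<union> ?C) \<union> region n i t) ?V) * card (fillings (lower n t) ?V)"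
    by (rule card_fillings_Un_below, use assms in \<open>fastforce simp: inner_def region_def lower_def\<close>,
        rule no0, use assms in \<open>auto simp: lower_def\<close>)
  moreover have "card (fillings ((inner i \<union> ?C) \<union> region n i t) ?V)
      = card (fillings (inner i \<union> ?C) ?V) * card (fillings (region n i t) ?V)"
    by (rule card_fillings_Un_left, fastforce simp: inner_def region_def, rule no3, auto simp: inner_def)
  moreover have "card (fillings (inner i \<union> ?C) ?V) = card (fillings (inner i) ?V) * card (fillings ?C ?V)"
    by (rule card_fillings_Un_left, fastforce simp: inner_def, rule no3, auto simp: inner_def)
  moreover have "card (fillings (inner i) ?V) = 2 ^ (i * (i - 1) div 2)"
    by (rule card_fillings_inner) (auto simp: inner_def class_values_def)
  moreover have "card (fillings ?C ?V) = 1"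
    by (rule card_fillings_forced[of _ _ 0]) (auto simp: class_values_def)
  moreover have "fillings (region n i t) ?V = fillings (region n i t) free_border_values"
    by (rule fillings_cong) (auto simp: region_def class_values_def)
  moreover have "card (fillings (lower n t) ?V) = 2 ^ ((n - t) * (n - t - 1) div 2)"
  proof (cases "t = n")
    \<comment> \<open>Here no border entry is \<open>3\<close>, and there is no constant
      row.\<close>
    case True
    then have "lower n t = {}" by (auto simp: lower_def)
    then show ?thesis using True by simp
  next
    case False
    let ?R = "{Suc t} \<times> {t..<n}"
    have "lower n t = ?R \<union> lower n (Suc t)" by (auto simp: lower_def)
    moreover have "card (fillings (?R \<union> lower n (Suc t)) ?V) = card (fillings ?R ?V) * card (fillings (lower n (Suc t)) ?V)"
      by (rule card_fillings_Un_below, force simp: lower_def, rule no0, use assms in \<open>auto simp: lower_def\<close>)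
    moreover have "card (fillings ?R ?V) = 1"
      by (rule card_fillings_forced[of _ _ 3]) (use assms in \<open>auto simp: class_values_def\<close>)
    moreover have "card (fillings (lower n (Suc t)) ?V) = 2 ^ (Suc (n - Suc t) * (n - Suc t) div 2)"
      by (rule card_fillings_lower) (use assms False in \<open>auto simp: lower_def class_values_def\<close>)
    moreover have "Suc (n - Suc t) * (n - Suc t) = (n - t) * (n - t - 1)" using False assms by (simp add: Suc_diff_Suc)
    ultimately show ?thesis by (simp only: mult_1_left)
  qed
  ultimately show ?thesis by (simp only: split region_count_def mult_1_right)
qed

lemma class_values_subset: "i < t \<Longrightarrow> x \<in> inner n \<Longrightarrow> class_values i t x \<subseteq> state_values x"
  by (auto simp: class_values_def state_values_def free_border_values_def inner_def)

lemma class_border_nonzero: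
  assumes "f \<in> fillings (inner n) (class_values i t)" "i < t" "i < j" "j < n"
  shows "f (Suc j, j) \<noteq> 0"
  using fillings_mem[OF assms(1), of "(Suc j, j)"] assms(2-)
  by (auto simp: class_values_def inner_def free_border_values_def state_values_def split: if_splits)

lemma class_border_not_three:
  assumes "f \<in> fillings (inner n) (class_values i t)" "i < t" "1 \<le> j" "j < t" "j < n"
  shows "f (Suc j, j) \<noteq> 3"
  using fillings_mem[OF assms(1), of "(Suc j, j)"] assms(2-)
  by (auto simp: class_values_def inner_def free_border_values_def state_values_def split: if_splits)

text \<open>The border entries tell the classes apart: if \<open>i' < i\<close>, the entry at
  \<open>(i + 1, i)\<close> is \<open>0\<close> in the first class but nonzero in the second, and
  similarly for threes. Applied twice with the roles exchanged, this makes the indices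
  equal.\<close>

lemma class_disjoint:
  assumes f: "f \<in> fillings (inner n) (class_values i t)" "i < t" "t \<le> n"
    and f': "f \<in> fillings (inner n) (class_values i' t')" "i' < t'" "t' \<le> n"
  shows "i \<le> i'" "t \<le> t'"
proof -
  show "i \<le> i'"
  proof (rule ccontr)
    assume "\<not> i \<le> i'"
    then have "f (Suc i, i) = 0" "f (Suc i, i) \<noteq> 0"
      using fillings_mem[OF f(1), of "(Suc i, i)"] f class_border_nonzero[OF f'(1,2), of i]
      by (auto simp: class_values_def inner_def)
    then show False by simp
  qed
  show "t \<le> t'"
  proof (rule ccontr)
    assume "\<not> t \<le> t'"
    then have "f (Suc t', t') = 3" "f (Suc t', t') \<noteq> 3"
      using fillings_mem[OF f'(1), of "(Suc t', t')"] f f' class_border_not_three[OF f(1,2), of t']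
      by (auto simp: class_values_def inner_def)
    then show False by simp
  qed
qed

lemma class_exists:
  assumes f: "f \<in> fillings (inner n) state_values" and n: "n \<ge> 1"
  obtains i t where "i < t" "t \<le> n" "f \<in> fillings (inner n) (class_values i t)"
proof -
  define Z where "Z = {j. 1 \<le> j \<and> j < n \<and> f (Suc j, j) = 0}"
  define T where "T = {j. 1 \<le> j \<and> j < n \<and> f (Suc j, j) = 3}"
  \<comment> \<open>The inserted \<open>0\<close> and \<open>n\<close> are the indices used when no
    border entry is \<open>0\<close> or \<open>3\<close>, respectively.\<close>
  define i where "i = Max (insert 0 Z)"
  define t where "t = Min (insert n T)"
  have finZ: "finite (insert 0 Z)" and finT: "finite (insert n T)" by (auto simp: Z_def T_def)
  have i: "i = 0 \<or> i \<in> Z" using Max_in[OF finZ] by (auto simp: i_def)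
  have t: "t = n \<or> t \<in> T" using Min_in[OF finT] by (auto simp: t_def)
  have i_max: "j \<le> i" if "j \<in> Z" for j using that finZ by (auto simp: i_def)
  have t_min: "t \<le> j" if "j \<in> T" for j using that finT by (auto simp: t_def)
  have t_le: "t \<le> n" using finT by (auto simp: t_def)
  have mem: "f x \<in> state_values x" if "x \<in> inner n" for x by (rule fillings_mem[OF f that])
  have col_zero: "f (r, i) = 0" if "(r, i) \<in> inner n" for r
  proof -
    have "f (Suc i, i) = 0" "(Suc i, i) \<in> inner n" using i that by (auto simp: Z_def inner_def)
    then show ?thesis
      using fillings_above[OF f, of "(Suc i, i)" "(r, i)"] that
      by (cases "r = Suc i") (auto simp: strictly_above_def inner_def)
  qed
  have row_three: "f (Suc t, j) = 3" if "(Suc t, j) \<in> inner n" for j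
  proof -
    have "f (Suc t, t) = 3" "(Suc t, t) \<in> inner n" using t that by (auto simp: T_def inner_def)
    then show ?thesis
      using fillings_left[OF f, of "(Suc t, t)" "(Suc t, j)"] that
      by (cases "j = t") (auto simp: strictly_left_def inner_def)
  qed
  \<comment> \<open>Otherwise the column of zeros and the row of threes would meet in
    \<open>(t + 1, i)\<close>.\<close>
  have "i < t"
  proof (rule ccontr)
    assume "\<not> i < t"
    moreover have "i < n" using i n by (auto simp: Z_def)
    moreover have "t \<noteq> 0" using t n by (auto simp: T_def)
    ultimately have "(Suc t, i) \<in> inner n" by (auto simp: inner_def)
    then show False using col_zero row_three by fastforce
  qed
  have "f x \<in> class_values i t x" if x: "x \<in> inner n" for x
  proof (cases x)
    case (Pair r j)
    have rj: "(r, j) \<in> inner n" using x Pair by simp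
    consider "j < i" | "j = i" | "i < j" "r \<le> t" "r = Suc j" | "i < j" "r \<le> t" "r \<noteq> Suc j"
      | "i < j" "r = Suc t" | "i < j" "r > Suc t" by linarith
    then show ?thesis
    proof cases
      case 1
      have "i < n" using i n by (auto simp: Z_def)
      then have mem_i: "(r, i) \<in> inner n" using 1 rj by (auto simp: inner_def)
      \<comment> \<open>A three here would spread left to column \<open>i\<close>, which consists of
        zeros.\<close>
      have "f (r, j) \<noteq> 3"
        using fillings_left[OF f _ _ mem_i rj] col_zero[OF mem_i] 1 by (auto simp: strictly_left_def)
      then show ?thesis using mem[OF rj] 1 Pair by (simp add: class_values_def)
    next
      case 2
      then show ?thesis using col_zero rj Pair by (simp add: class_values_def)
    next
      case 3
      then have "j \<notin> Z" "j \<notin> T" using i_max[of j] t_min[of j] by auto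
      then have "f (r, j) \<noteq> 0" "f (r, j) \<noteq> 3" using 3 rj by (auto simp: Z_def T_def inner_def)
      then show ?thesis
        using mem[OF rj] 3 Pair by (auto simp: class_values_def free_border_values_def state_values_def)
    next
      case 4
      then show ?thesis
        using mem[OF rj] Pair by (auto simp: class_values_def free_border_values_def state_values_def)
    next
      case 5
      then show ?thesis using row_three rj Pair by (simp add: class_values_def)
    next
      case 6
      have "t \<noteq> 0" using \<open>i < t\<close> by simp
      then have mem_t: "(Suc t, j) \<in> inner n" using 6 rj by (auto simp: inner_def)
      \<comment> \<open>A zero here would spread up to row \<open>t + 1\<close>, which consists of
        threes.\<close>
      have "f (r, j) \<noteq> 0"
        using fillings_above[OF f _ _ mem_t rj] row_three[OF mem_t] 6 by (auto simp: strictly_above_def)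
      then show ?thesis using mem[OF rj] 6 Pair by (simp add: class_values_def)
    qed
  qed
  then have "f \<in> fillings (inner n) (class_values i t)" by (rule fillings_restrict_values[OF f])
  then show ?thesis using that \<open>i < t\<close> t_le by blast
qed

lemma card_fillings_state_values:
  assumes n: "n \<ge> 1"
  shows "int (card (fillings (inner n) state_values)) =
    (\<Sum>(i, j, k) \<in> {(i, j, k). i + j + k = n - 1}. spine_f i j k)"
proof -
  let ?I = "{(i, t). i < t \<and> t \<le> n}"
  let ?F = "\<lambda>p. fillings (inner n) (class_values (fst p) (snd p))"
  have fin: "finite ?I" by (rule finite_subset[of _ "{..n} \<times> {..n}"]) auto
  have "fillings (inner n) state_values = (\<Union>p\<in>?I. ?F p)"
  proof
    show "fillings (inner n) state_values \<subseteq> (\<Union>p\<in>?I. ?F p)"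
    proof
      fix f assume "f \<in> fillings (inner n) state_values"
      then obtain i t where "i < t" "t \<le> n" "f \<in> ?F (i, t)" using n by (auto elim: class_exists)
      then show "f \<in> (\<Union>p\<in>?I. ?F p)" by (intro UN_I[of "(i, t)"]) auto
    qed
    have "?F p \<subseteq> fillings (inner n) state_values" if "p \<in> ?I" for p
      by (rule fillings_mono, rule class_values_subset) (use that in auto)
    then show "(\<Union>p\<in>?I. ?F p) \<subseteq> fillings (inner n) state_values" by blast
  qed
  moreover have "?F p \<inter> ?F q = {}" if "p \<in> ?I" "q \<in> ?I" "p \<noteq> q" for p q
  proof (rule ccontr)
    assume "?F p \<inter> ?F q \<noteq> {}"
    then obtain f where "f \<in> ?F p" "f \<in> ?F q" by blast
    then have "fst p \<le> fst q" "snd p \<le> snd q" "fst q \<le> fst p" "snd q \<le> snd p"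
      using class_disjoint[of f n "fst p" "snd p" "fst q" "snd q"]
        class_disjoint[of f n "fst q" "snd q" "fst p" "snd p"] that by auto
    then show False using \<open>p \<noteq> q\<close> by (simp add: prod_eq_iff)
  qed
  moreover have "finite (?F p)" if "p \<in> ?I" for p
    by (intro finite_fillings finite_inner finite_subset[OF class_values_subset[of "fst p" "snd p"]])
      (use that in \<open>auto simp: state_values_def\<close>)
  ultimately have "card (fillings (inner n) state_values) = (\<Sum>p\<in>?I. card (?F p))"
    using fin by (simp add: card_UN_disjoint)
  also have "int \<dots> = (\<Sum>p\<in>?I. int (card (?F p)))" by simp
  also have "\<dots> = (\<Sum>(i, j, k) \<in> {(i, j, k). i + j + k = n - 1}. spine_f i j k)"
  \<comment> \<open>\<open>i\<close> and \<open>n - t\<close> index the powers of two from the two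
    triangles, and the middle index is what remains of \<open>n - 1\<close>.\<close>
  proof (rule sum.reindex_bij_witness[where i = "\<lambda>(i, j, k). (i, Suc (i + j))"
        and j = "\<lambda>(i, t). (i, t - Suc i, n - t)"])
    fix p assume p: "p \<in> ?I"
    obtain i t where it: "p = (i, t)" by (cases p)
    have "int (region_count (Suc (i + (t - Suc i) + (n - t))) i (Suc (i + (t - Suc i))))
        = spine_g i (t - Suc i) (n - t)" by (rule region_count_stair)
    then have "int (region_count n i t) = spine_g i (t - Suc i) (n - t)"
      using p it by simp
    then show "(case (case p of (i, t) \<Rightarrow> (i, t - Suc i, n - t)) of (i, j, k) \<Rightarrow> spine_f i j k) = int (card (?F p))"
      using p it by (simp add: card_fillings_class spine_f_def power_add)
  qed (use n in auto)
  finally show ?thesis .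
qed

section \<open>The order in terms of single cells\<close>

definition has_above :: "cell set \<Rightarrow> cell \<Rightarrow> bool" where
  "has_above T c \<longleftrightarrow> (\<exists>d\<in>T. strictly_above d c)"

definition has_left :: "cell set \<Rightarrow> cell \<Rightarrow> bool" where
  "has_left T c \<longleftrightarrow> (\<exists>d\<in>T. strictly_left d c)"

lemma has_above_iff: "has_above T (i, j) \<longleftrightarrow> (\<exists>i'<i. (i', j) \<in> T)"
  by (force simp: has_above_def strictly_above_def)

lemma has_left_iff: "has_left T (i, j) \<longleftrightarrow> (\<exists>j'>j. (i, j') \<in> T)"
  by (force simp: has_left_def strictly_left_def)

lemma board_iff: "(i, j) \<in> board n \<longleftrightarrow> 1 \<le> i \<and> 1 \<le> j \<and> i \<le> Suc j \<and> j \<le> n \<and> i \<le> n"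
  by (auto simp: board_def)

lemma inner_iff: "(i, j) \<in> inner n \<longleftrightarrow> 2 \<le> i \<and> i \<le> Suc j \<and> j < n"
  by (auto simp: inner_def)

lemma border_inner: "(Suc j, j) \<in> inner n \<Longrightarrow> (Suc j, j) \<in> border n"
  by (auto simp: border_def inner_def)

context
  fixes n :: nat and T :: "cell set"
  assumes T: "fb_tableau n T"
begin

lemma tableau_board: "c \<in> T \<Longrightarrow> c \<in> board n"
  using T by (auto simp: fb_tableau_def)

lemma tableau_root: "(1, n) \<in> T"
  using T by (auto simp: fb_tableau_def root_def)

lemma tableau_border: "(Suc j, j) \<in> inner n \<Longrightarrow> (Suc j, j) \<in> T"
  using T border_inner by (auto simp: fb_tableau_def)

lemma tableau_supported: "c \<in> T \<Longrightarrow> c \<noteq> (1, n) \<Longrightarrow> has_above T c \<or> has_left T c"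
  using T unfolding fb_tableau_def has_above_def has_left_def root_def by blast

text \<open>The topmost nonempty cell of the column; \<open>j < n\<close> ensures that it is not the
  root.\<close>

lemma exists_up_arrow:
  assumes "(i, j) \<in> T" "j < n"
  shows "\<exists>i'\<le>i. up_arrow n T (i', j)"
proof -
  define m where "m = (LEAST i'. (i', j) \<in> T)"
  have "(m, j) \<in> T" "m \<le> i" unfolding m_def using assms by (auto intro: LeastI Least_le)
  moreover have "(i', j) \<notin> T" if "i' < m" for i'
    using that unfolding m_def by (rule not_less_Least)
  ultimately show ?thesis
    using assms(2) by (intro exI[of _ m]) (auto simp: up_arrow_def root_def strictly_above_def)
qed

lemma exists_left_arrow:
  assumes "(i, j) \<in> T" "2 \<le> i"
  shows "\<exists>j'\<ge>j. left_arrow n T (i, j')"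
proof -
  define m where "m = Max {j'. (i, j') \<in> T}"
  have fin: "finite {j'. (i, j') \<in> T}"
    by (rule finite_subset[of _ "{..n}"]) (auto dest!: tableau_board simp: board_iff)
  have "(i, m) \<in> T" using Max_in[OF fin] assms(1) unfolding m_def by blast
  moreover have max: "j' \<le> m" if "(i, j') \<in> T" for j'
    unfolding m_def using fin that by simp
  ultimately show ?thesis
    using assms by (intro exI[of _ m]) (fastforce simp: left_arrow_def root_def strictly_left_def)
qed

section \<open>Rows, columns and free cells without reference to arrows\<close>

lemma Row_iff:
  assumes "(i, j) \<in> board n"
  shows "(i, j) \<in> Row n T \<longleftrightarrow> i = 1 \<or> (\<exists>j'\<ge>j. (i, j') \<in> T)"
proof
  assume "(i, j) \<in> Row n T"
  then obtain l where "left_arrow n T l \<or> l = root n" "l = (i, j) \<or> strictly_left l (i, j)"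
    by (auto simp: Row_def)
  then show "i = 1 \<or> (\<exists>j'\<ge>j. (i, j') \<in> T)"
    by (cases l) (auto simp: root_def left_arrow_def strictly_left_def)
next
  assume *: "i = 1 \<or> (\<exists>j'\<ge>j. (i, j') \<in> T)"
  show "(i, j) \<in> Row n T"
  proof (cases "i = 1")
    case True
    then have "root n = (i, j) \<or> strictly_left (root n) (i, j)"
      using assms by (auto simp: root_def strictly_left_def board_iff)
    then show ?thesis using assms unfolding Row_def by blast
  next
    case False
    then obtain l where l: "j \<le> l" "(i, l) \<in> T" using * by blast
    then obtain j' where "l \<le> j'" and arrow: "left_arrow n T (i, j')"
      using exists_left_arrow[OF l(2)] assms False by (auto simp: board_iff)
    then have "(i, j') = (i, j) \<or> strictly_left (i, j') (i, j)"
      using l by (auto simp: strictly_left_def)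
    then show ?thesis using assms arrow unfolding Row_def by blast
  qed
qed

lemma Col_iff:
  assumes "(i, j) \<in> board n"
  shows "(i, j) \<in> Col n T \<longleftrightarrow> j = n \<or> (\<exists>i'\<le>i. (i', j) \<in> T)"
proof
  assume "(i, j) \<in> Col n T"
  then obtain u where "up_arrow n T u \<or> u = root n" "u = (i, j) \<or> strictly_above u (i, j)"
    by (auto simp: Col_def)
  then show "j = n \<or> (\<exists>i'\<le>i. (i', j) \<in> T)"
    by (cases u) (auto simp: root_def up_arrow_def strictly_above_def)
next
  assume *: "j = n \<or> (\<exists>i'\<le>i. (i', j) \<in> T)"
  show "(i, j) \<in> Col n T"
  proof (cases "j = n")
    case True
    then have "root n = (i, j) \<or> strictly_above (root n) (i, j)"
      using assms by (auto simp: root_def strictly_above_def board_iff)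
    then show ?thesis using assms unfolding Col_def by blast
  next
    case False
    then obtain l where l: "l \<le> i" "(l, j) \<in> T" using * by blast
    then obtain i' where "i' \<le> l" and arrow: "up_arrow n T (i', j)"
      using exists_up_arrow[OF l(2)] assms False by (auto simp: board_iff)
    then have "(i', j) = (i, j) \<or> strictly_above (i', j) (i, j)"
      using l by (auto simp: strictly_above_def)
    then show ?thesis using assms arrow unfolding Col_def by blast
  qed
qed

text \<open>A cell with tableau cells above it and to its left is off the first row and the leftmost
  column. Conversely, off these the extreme nonempty cells of its row and column are arrows and not
  the root.\<close>

lemma free_cell_iff: "free_cell n T c \<longleftrightarrow> c \<in> inner n \<and> has_above T c \<and> has_left T c"
proof
  assume free: "free_cell n T c"
  obtain i j where c: "c = (i, j)" by (cases c)
  obtain i' where i': "up_arrow n T (i', j)" "i' < i"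
    using free c by (auto simp: free_cell_def strictly_above_def)
  obtain j' where j': "left_arrow n T (i, j')" "j < j'"
    using free c by (auto simp: free_cell_def strictly_left_def)
  have "(i', j) \<in> T" "(i, j') \<in> T" using i' j' by (auto simp: up_arrow_def left_arrow_def)
  then show "c \<in> inner n \<and> has_above T c \<and> has_left T c"
    using i' j' free c tableau_board[of "(i', j)"] tableau_board[of "(i, j')"]
    by (auto simp: inner_iff board_iff has_above_iff has_left_iff free_cell_def)
next
  assume *: "c \<in> inner n \<and> has_above T c \<and> has_left T c"
  obtain i j where c: "c = (i, j)" by (cases c)
  obtain i' where i': "(i', j) \<in> T" "i' < i" using * c by (auto simp: has_above_iff)
  obtain j' where j': "(i, j') \<in> T" "j < j'" using * c by (auto simp: has_left_iff)
  obtain u where "u \<le> i'" "up_arrow n T (u, j)" using exists_up_arrow[OF i'(1)] * c by (auto simp: inner_iff)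
  moreover obtain l where "j' \<le> l" "left_arrow n T (i, l)"
    using exists_left_arrow[OF j'(1)] * c by (auto simp: inner_iff)
  moreover have "strictly_above (u, j) c" "strictly_left (i, l) c" "c \<in> board n"
    using * c i' j' \<open>u \<le> i'\<close> \<open>j' \<le> l\<close>
    by (auto simp: inner_iff board_iff strictly_above_def strictly_left_def)
  ultimately show "free_cell n T c" unfolding free_cell_def by blast
qed

lemma dot_iff: "has_above T c \<Longrightarrow> has_left T c \<Longrightarrow> dot n T c \<longleftrightarrow> c \<in> T"
  by (auto simp: dot_def has_above_def has_left_def left_arrow_def up_arrow_def)

end

text \<open>Away from column \<open>n\<close>, membership of \<open>(i, j)\<close> in
  \<open>Col\<close> says that something nonempty lies strictly above \<open>(i + 1, j)\<close>, so
  \<open>has_above\<close> is \<open>Col\<close> shifted down by one row. Cells without an inner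
  cell below them lie in column \<open>n\<close> or on the border and belong to every
  \<open>Col\<close>.\<close>

lemma Col_subset_iff:
  assumes S: "fb_tableau n S" and T: "fb_tableau n T"
  shows "Col n S \<subseteq> Col n T \<longleftrightarrow> (\<forall>c\<in>inner n. has_above S c \<longrightarrow> has_above T c)"
proof (intro iffI ballI impI subsetI)
  fix c assume sub: "Col n S \<subseteq> Col n T" and c: "c \<in> inner n" "has_above S c"
  obtain i j where ij: "c = (Suc i, j)" using c(1) by (cases c; cases "fst c") (auto simp: inner_iff)
  have b: "(i, j) \<in> board n" using c(1) ij by (auto simp: inner_iff board_iff)
  have "(i, j) \<in> Col n S" using c(2) ij by (auto simp: Col_iff[OF S b] has_above_iff)
  then have "(i, j) \<in> Col n T" using sub by blast
  then show "has_above T c" using ij c(1) by (auto simp: Col_iff[OF T b] has_above_iff inner_iff less_Suc_eq_le)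
next
  fix c assume *: "\<forall>c\<in>inner n. has_above S c \<longrightarrow> has_above T c" and c: "c \<in> Col n S"
  obtain i j where ij: "c = (i, j)" by (cases c)
  have b: "(i, j) \<in> board n" using c ij by (auto simp: Col_def)
  have "j = n \<or> (\<exists>i'\<le>i. (i', j) \<in> T)"
  proof (cases "j = n \<or> i = Suc j")
    case True
    then show ?thesis using tableau_border[OF T, of j] b by (auto simp: inner_iff board_iff)
  next
    case False
    then have "(Suc i, j) \<in> inner n" using b by (auto simp: inner_iff board_iff)
    moreover have "has_above S (Suc i, j)"
      using c ij False by (auto simp: Col_iff[OF S b] has_above_iff less_Suc_eq_le)
    ultimately have "has_above T (Suc i, j)" using * by blast
    then show ?thesis by (auto simp: has_above_iff)
  qed
  then show "c \<in> Col n T" using ij by (simp add: Col_iff[OF T b])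
qed

text \<open>Here the shift is by one column to the right, and the exceptional cells are those of the
  first row and the border.\<close>

lemma Row_subset_iff:
  assumes S: "fb_tableau n S" and T: "fb_tableau n T"
  shows "Row n S \<subseteq> Row n T \<longleftrightarrow> (\<forall>c\<in>inner n. has_left S c \<longrightarrow> has_left T c)"
proof (intro iffI ballI impI subsetI)
  fix c assume sub: "Row n S \<subseteq> Row n T" and c: "c \<in> inner n" "has_left S c"
  obtain i j where ij: "c = (i, j)" by (cases c)
  have b: "(i, Suc j) \<in> board n" using c(1) ij by (auto simp: inner_iff board_iff)
  have "(i, Suc j) \<in> Row n S" using c(2) ij by (auto simp: Row_iff[OF S b] has_left_iff)
  then have "(i, Suc j) \<in> Row n T" using sub by blast
  then show "has_left T c" using ij c(1) by (auto simp: Row_iff[OF T b] has_left_iff inner_iff Suc_le_eq)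
next
  fix c assume *: "\<forall>c\<in>inner n. has_left S c \<longrightarrow> has_left T c" and c: "c \<in> Row n S"
  obtain i j where ij: "c = (i, j)" by (cases c)
  have b: "(i, j) \<in> board n" using c ij by (auto simp: Row_def)
  have "i = 1 \<or> (\<exists>j'\<ge>j. (i, j') \<in> T)"
  proof (cases "i = 1 \<or> i = Suc j")
    case True
    then show ?thesis using tableau_border[OF T, of j] b by (auto simp: inner_iff board_iff)
  next
    case False
    have j: "j = Suc (j - 1)" using b by (simp add: board_iff)
    have "(i, j - 1) \<in> inner n" using b False by (auto simp: inner_iff board_iff)
    obtain j' where "j \<le> j'" "(i, j') \<in> S" using c ij False by (auto simp: Row_iff[OF S b])
    then have "has_left S (i, j - 1)"
      using j by (auto simp: has_left_iff intro!: exI[of _ j'])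
    then have "has_left T (i, j - 1)" using * \<open>(i, j - 1) \<in> inner n\<close> by blast
    then show ?thesis using j by (auto simp: has_left_iff)
  qed
  then show "c \<in> Row n T" using ij by (simp add: Row_iff[OF T b])
qed

text \<open>Under the first two conditions something above in \<open>S\<close> persists in
  \<open>T\<close>, and something to the left in \<open>T\<close> was already there in
  \<open>S\<close>; this simplifies being free in both.\<close>

lemma es_le_iff:
  assumes S: "fb_tableau n S" and T: "fb_tableau n T"
  shows "es_le n S T \<longleftrightarrow> (\<forall>c\<in>inner n. (has_above S c \<longrightarrow> has_above T c) \<and> (has_left T c \<longrightarrow> has_left S c) \<and>
    (has_above S c \<and> has_left T c \<and> c \<in> S \<longrightarrow> c \<in> T))"
  unfolding es_le_def Col_subset_iff[OF S T] Row_subset_iff[OF T S] free_cell_iff[OF S] free_cell_iff[OF T]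
  using dot_iff[OF S] dot_iff[OF T] by blast

text \<open>A nonempty cell that is neither the root, nor on the border, nor free is topmost in its
  column or leftmost in its row. Such a cell can be located from \<open>has_above\<close> or
  \<open>has_left\<close>, which change between it and its neighbour.\<close>

lemma tableau_subset:
  assumes S: "fb_tableau n S" and T: "fb_tableau n T"
    and eq: "\<And>c. c \<in> inner n \<Longrightarrow> has_above S c = has_above T c"
      "\<And>c. c \<in> inner n \<Longrightarrow> has_left S c = has_left T c"
    and sub: "\<And>c. c \<in> inner n \<Longrightarrow> has_above S c \<Longrightarrow> has_left S c \<Longrightarrow> c \<in> S \<Longrightarrow> c \<in> T"
  shows "S \<subseteq> T"
proof
  fix c assume c: "c \<in> S"
  obtain i j where ij: "c = (i, j)" by (cases c)
  have b: "(i, j) \<in> board n" using tableau_board[OF S] c ij by simp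
  consider "c = (1, n)" | "i = Suc j" "j < n" "i \<noteq> 1"
    | "j < n" "i \<le> j" "i = 1 \<or> \<not> has_above S c" | "2 \<le> i" "i \<le> j" "j = n \<or> \<not> has_left S c"
    | "c \<in> inner n" "has_above S c" "has_left S c"
    using b ij by (fastforce simp: board_iff inner_iff)
  then show "c \<in> T"
  proof cases
    case 1 then show ?thesis using tableau_root[OF T] by simp
  next
    case 2 then show ?thesis using tableau_border[OF T, of j] b ij by (auto simp: inner_iff board_iff)
  next
    case 3
    then have mem: "(Suc i, j) \<in> inner n" using b by (auto simp: inner_iff board_iff)
    have "has_above S (Suc i, j)" using c ij by (auto simp: has_above_iff)
    \<comment> \<open>This cell of \<open>T\<close> is not strictly above \<open>c\<close>, because
      \<open>c\<close> is in the first row or \<open>has_above\<close> fails at \<open>c\<close> for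
      both tableaux.\<close>
    then obtain i' where i': "i' \<le> i" "(i', j) \<in> T" using eq(1)[OF mem] by (auto simp: has_above_iff less_Suc_eq_le)
    have "\<not> i' < i"
    proof
      assume lt: "i' < i"
      have "1 \<le> i'" using tableau_board[OF T i'(2)] by (simp add: board_iff)
      then have "c \<in> inner n" "\<not> has_above S c" using lt 3 ij by (auto simp: inner_iff)
      then show False using eq(1)[of c] lt i' ij by (auto simp: has_above_iff)
    qed
    then show ?thesis using i' ij by simp
  next
    case 4
    then have mem: "(i, j - 1) \<in> inner n" using b by (auto simp: inner_iff board_iff)
    have j: "j = Suc (j - 1)" using 4 by simp
    have "has_left S (i, j - 1)" using c ij j by (auto simp: has_left_iff)
    then obtain j' where j': "j \<le> j'" "(i, j') \<in> T" using eq(2)[OF mem] j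
      by (metis Suc_le_eq has_left_iff)
    have "\<not> j < j'"
    proof
      assume lt: "j < j'"
      have "j' \<le> n" using tableau_board[OF T j'(2)] by (simp add: board_iff)
      then have "c \<in> inner n" "\<not> has_left S c" using lt 4 ij by (auto simp: inner_iff)
      then show False using eq(2)[of c] lt j' ij by (auto simp: has_left_iff)
    qed
    then show ?thesis using j' ij by simp
  next
    case 5 then show ?thesis using sub c by simp
  qed
qed

lemma tableau_eqI:
  assumes "fb_tableau n S" "fb_tableau n T"
    and "\<And>c. c \<in> inner n \<Longrightarrow> has_above S c = has_above T c"
      "\<And>c. c \<in> inner n \<Longrightarrow> has_left S c = has_left T c"
      "\<And>c. c \<in> inner n \<Longrightarrow> has_above S c \<Longrightarrow> has_left S c \<Longrightarrow> c \<in> S \<longleftrightarrow> c \<in> T"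
  shows "S = T"
  using tableau_subset[of n S T] tableau_subset[of n T S] assms by blast

section \<open>Tableaux as fillings\<close>

text \<open>A cell with nothing above and nothing to the left also receives \<open>0\<close>; the
  encoding is faithful only for tableaux without such cells.\<close>

definition state :: "cell set \<Rightarrow> cell \<Rightarrow> nat" where
  "state T c = (if \<not> has_above T c then 0 else if \<not> has_left T c then 3 else if c \<in> T then 2 else 1)"

text \<open>These will turn out to be the elements of the spine.\<close>

definition covered_tableaux :: "nat \<Rightarrow> cell set set" where
  "covered_tableaux n = {T. fb_tableau n T \<and> (\<forall>c\<in>inner n. has_above T c \<or> has_left T c)}"

text \<open>Besides the root and the dots: an up-arrow sits at the lowest zero of a column, or in
  the first row if there is none; a left-arrow sits at the rightmost three of a row, or in the
  leftmost column if there is none. The premises about \<open>inner n\<close> allow for border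
  cells, which have no next cell.\<close>

definition tableau_of :: "nat \<Rightarrow> (cell \<Rightarrow> nat) \<Rightarrow> cell set" where
  "tableau_of n f = {(i, j) \<in> board n. (i, j) = (1, n)
     \<or> (i, j) \<in> inner n \<and> f (i, j) = 2
     \<or> j < n \<and> (i = 1 \<or> f (i, j) = 0) \<and> ((Suc i, j) \<in> inner n \<longrightarrow> f (Suc i, j) \<noteq> 0)
     \<or> 2 \<le> i \<and> (j = n \<or> f (i, j) = 3) \<and> ((i, j - 1) \<in> inner n \<longrightarrow> f (i, j - 1) \<noteq> 3)}"

lemma tableau_of_iff: "(i, j) \<in> tableau_of n f \<longleftrightarrow> (i, j) \<in> board n \<and> ((i, j) = (1, n)
     \<or> (i, j) \<in> inner n \<and> f (i, j) = 2
     \<or> j < n \<and> (i = 1 \<or> f (i, j) = 0) \<and> ((Suc i, j) \<in> inner n \<longrightarrow> f (Suc i, j) \<noteq> 0)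
     \<or> 2 \<le> i \<and> (j = n \<or> f (i, j) = 3) \<and> ((i, j - 1) \<in> inner n \<longrightarrow> f (i, j - 1) \<noteq> 3))"
  by (simp add: tableau_of_def)

context
  fixes n :: nat and f :: "cell \<Rightarrow> nat"
  assumes f: "f \<in> fillings (inner n) state_values"
begin

text \<open>The zeros form an initial segment of the column, and the up-arrow sits just above the
  first nonzero entry, so exactly the nonzero entries have something above.\<close>

lemma has_above_tableau_of:
  assumes c: "c \<in> inner n"
  shows "has_above (tableau_of n f) c \<longleftrightarrow> f c \<noteq> 0"
proof -
  obtain r j where rj: "c = (r, j)" by (cases c)
  have r: "2 \<le> r" "r \<le> Suc j" "j < n" using c rj by (auto simp: inner_iff)
  show ?thesis
  proof
    assume "has_above (tableau_of n f) c"
    then obtain i where i: "i < r" "(i, j) \<in> tableau_of n f" using rj by (auto simp: has_above_iff)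
    show "f c \<noteq> 0"
    proof
      assume zero: "f c = 0"
      have "f (i', j) = 0" if "2 \<le> i'" "i' \<le> r" for i'
        using fillings_above[OF f zero, of "(i', j)"] that c r rj zero
        by (cases "i' = r") (auto simp: strictly_above_def inner_iff)
      then show False using i r by (auto simp: tableau_of_iff inner_iff board_iff)
    qed
  next
    assume nz: "f c \<noteq> 0"
    define m where "m = (LEAST i. 2 \<le> i \<and> f (i, j) \<noteq> 0)"
    have m: "2 \<le> m" "f (m, j) \<noteq> 0" "m \<le> r"
      using LeastI[of "\<lambda>i. 2 \<le> i \<and> f (i, j) \<noteq> 0" r] Least_le[of "\<lambda>i. 2 \<le> i \<and> f (i, j) \<noteq> 0" r] nz r rj
      by (auto simp: m_def)
    have "f (i, j) = 0" if "2 \<le> i" "i < m" for i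
      using not_less_Least[of i "\<lambda>i. 2 \<le> i \<and> f (i, j) \<noteq> 0"] that by (auto simp: m_def)
    moreover obtain i where i: "m = Suc i" using m by (cases m) auto
    ultimately have "(i, j) \<in> tableau_of n f"
      using m r by (cases "i = 1") (auto simp: tableau_of_iff board_iff)
    then show "has_above (tableau_of n f) c" using rj i m by (auto simp: has_above_iff intro!: exI[of _ i])
  qed
qed

lemma has_left_tableau_of:
  assumes c: "c \<in> inner n"
  shows "has_left (tableau_of n f) c \<longleftrightarrow> f c \<noteq> 3"
proof -
  obtain r j where rj: "c = (r, j)" by (cases c)
  have r: "2 \<le> r" "r \<le> Suc j" "j < n" using c rj by (auto simp: inner_iff)
  show ?thesis
  proof
    assume "has_left (tableau_of n f) c"
    then obtain j' where j': "j < j'" "(r, j') \<in> tableau_of n f" using rj by (auto simp: has_left_iff)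
    show "f c \<noteq> 3"
    proof
      assume three: "f c = 3"
      have *: "f (r, l) = 3" if "j \<le> l" "l < n" for l
        using fillings_left[OF f three, of "(r, l)"] that c r rj three
        by (cases "l = j") (auto simp: strictly_left_def inner_iff)
      have "j' \<le> n" using j' by (auto simp: tableau_of_iff board_iff)
      then have "f (r, j' - 1) = 3" "j' < n \<Longrightarrow> f (r, j') = 3" using * j' by auto
      then show False using j' r by (auto simp: tableau_of_iff inner_iff board_iff)
    qed
  next
    assume nt: "f c \<noteq> 3"
    let ?S = "{l. j \<le> l \<and> l < n \<and> f (r, l) \<noteq> 3}"
    define m where "m = Max ?S"
    have fin: "finite ?S" by simp
    have "j \<in> ?S" using nt r rj by simp
    then have "m \<in> ?S" unfolding m_def by (intro Max_in[OF fin]) blast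
    then have m: "j \<le> m" "m < n" "f (r, m) \<noteq> 3" by auto
    have "f (r, l) = 3" if "m < l" "l < n" for l
    proof (rule ccontr)
      assume "f (r, l) \<noteq> 3"
      then have "l \<le> m" unfolding m_def using that m by (intro Max_ge[OF fin]) auto
      then show False using that by simp
    qed
    then have "(r, Suc m) \<in> tableau_of n f"
      using m r by (cases "Suc m = n") (auto simp: tableau_of_iff board_iff)
    then show "has_left (tableau_of n f) c" using rj m by (auto simp: has_left_iff intro!: exI[of _ "Suc m"])
  qed
qed

lemma state_tableau_of:
  assumes c: "c \<in> inner n"
  shows "state (tableau_of n f) c = f c"
proof -
  obtain r j where rj: "c = (r, j)" by (cases c)
  have "f c \<in> {0, 1, 2, 3}" using fillings_mem[OF f c] by (auto simp: state_values_def split: if_splits)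
  moreover have "f c \<noteq> 0 \<Longrightarrow> f c \<noteq> 3 \<Longrightarrow> c \<in> tableau_of n f \<longleftrightarrow> f c = 2"
    using c rj by (auto simp: tableau_of_iff inner_iff board_iff)
  ultimately show ?thesis
    by (auto simp: state_def has_above_tableau_of[OF c] has_left_tableau_of[OF c])
qed

text \<open>An inner cell is supported because its value is not both \<open>0\<close> and
  \<open>3\<close>; nonempty cells of the first row and the leftmost column are supported by the
  root.\<close>

lemma tableau_of_covered:
  assumes n: "n \<ge> 1"
  shows "tableau_of n f \<in> covered_tableaux n"
proof -
  have "c \<in> tableau_of n f" if c: "c \<in> border n" for c
  proof -
    obtain j where j: "c = (Suc j, j)" "1 \<le> j" "j < n"
      using c by (cases c) (auto simp: border_def)
    then have "f c \<in> {0, 2, 3}" "c \<in> inner n"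
      using fillings_mem[OF f, of c] by (auto simp: state_values_def inner_iff)
    then show ?thesis using j by (auto simp: tableau_of_iff board_iff inner_iff)
  qed
  moreover have "\<exists>d\<in>tableau_of n f. strictly_left d c \<or> strictly_above d c"
    if c: "c \<in> tableau_of n f" "c \<noteq> root n" for c
  proof -
    obtain i j where ij: "c = (i, j)" by (cases c)
    have b: "(i, j) \<in> board n" using c ij by (simp add: tableau_of_iff)
    have root: "(1, n) \<in> tableau_of n f" using n by (simp add: tableau_of_iff board_iff)
    consider "c \<in> inner n" | "i = 1" "j < n" | "2 \<le> i" "j = n"
      using b c ij by (fastforce simp: board_iff inner_iff root_def)
    then show ?thesis
    proof cases
      case 1
      then have "has_above (tableau_of n f) c \<or> has_left (tableau_of n f) c"
        by (cases "f c = 0") (auto simp: has_above_tableau_of has_left_tableau_of)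
      then show ?thesis unfolding has_above_def has_left_def by blast
    next
      case 2
      then show ?thesis using root ij by (intro bexI[OF _ root]) (simp add: strictly_left_def)
    next
      case 3
      then show ?thesis using root ij by (intro bexI[OF _ root]) (simp add: strictly_above_def)
    qed
  qed
  ultimately have "fb_tableau n (tableau_of n f)"
    using n unfolding fb_tableau_def by (auto simp: tableau_of_iff root_def board_iff)
  moreover have "f c \<noteq> 0 \<or> f c \<noteq> 3" for c by (cases "f c = 0") simp_all
  ultimately show ?thesis
    by (simp add: covered_tableaux_def has_above_tableau_of has_left_tableau_of)
qed

end

lemma covered_fb: "T \<in> covered_tableaux n \<Longrightarrow> fb_tableau n T"
  by (simp add: covered_tableaux_def)

lemma covered_above_iff: "has_above T c \<longleftrightarrow> state T c \<noteq> 0"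
  by (simp add: state_def)

lemma covered_left_iff: "T \<in> covered_tableaux n \<Longrightarrow> c \<in> inner n \<Longrightarrow> has_left T c \<longleftrightarrow> state T c \<noteq> 3"
  by (auto simp: state_def covered_tableaux_def)

lemma state_filling:
  assumes T: "T \<in> covered_tableaux n"
  shows "restrict (state T) (inner n) \<in> fillings (inner n) state_values"
proof (rule fillingsI)
  have "state T c \<in> state_values c" if c: "c \<in> inner n" for c
  proof -
    have "c \<in> T" if "fst c = Suc (snd c)"
      using tableau_border[OF covered_fb[OF T], of "snd c"] that c by (cases c) auto
    then show ?thesis by (auto simp: state_def state_values_def)
  qed
  then show "restrict (state T) (inner n) \<in> Pi\<^sub>E (inner n) state_values" by simp
next
  fix x y assume xy: "x \<in> inner n" "y \<in> inner n" "strictly_above x y" "restrict (state T) (inner n) y = 0"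
  then have "\<not> has_above T y" by (simp add: covered_above_iff)
  then have "\<not> has_above T x" using xy(3) by (fastforce simp: has_above_def strictly_above_def)
  then show "restrict (state T) (inner n) x = 0" using xy by (simp add: covered_above_iff)
next
  fix x y assume xy: "x \<in> inner n" "y \<in> inner n" "strictly_left x y" "restrict (state T) (inner n) y = 3"
  then have "\<not> has_left T y" using covered_left_iff[OF T xy(2)] by simp
  then have "\<not> has_left T x" using xy(3) by (fastforce simp: has_left_def strictly_left_def)
  then show "restrict (state T) (inner n) x = 3" using xy covered_left_iff[OF T xy(1)] by simp
qed

lemma bij_betw_state:
  assumes n: "n \<ge> 1"
  shows "bij_betw (\<lambda>T. restrict (state T) (inner n)) (covered_tableaux n) (fillings (inner n) state_values)"
  unfolding bij_betw_def
proof
  show "inj_on (\<lambda>T. restrict (state T) (inner n)) (covered_tableaux n)"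
  proof
    fix S T assume S: "S \<in> covered_tableaux n" and T: "T \<in> covered_tableaux n"
      and eq: "restrict (state S) (inner n) = restrict (state T) (inner n)"
    have eq: "state S c = state T c" if "c \<in> inner n" for c
      using fun_cong[OF eq, of c] that by simp
    show "S = T"
    proof (rule tableau_eqI[OF covered_fb[OF S] covered_fb[OF T]])
      fix c assume c: "c \<in> inner n"
      show above: "has_above S c = has_above T c" by (simp add: covered_above_iff eq[OF c])
      show left: "has_left S c = has_left T c" by (simp add: covered_left_iff[OF S c] covered_left_iff[OF T c] eq[OF c])
      show "c \<in> S \<longleftrightarrow> c \<in> T" if "has_above S c" "has_left S c"
        using eq[OF c] that above left by (auto simp: state_def split: if_splits)
    qed
  qed
  show "(\<lambda>T. restrict (state T) (inner n)) ` covered_tableaux n = fillings (inner n) state_values"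
  proof (intro equalityI subsetI)
    fix f assume f: "f \<in> fillings (inner n) state_values"
    have "restrict (state (tableau_of n f)) (inner n) = f"
      by (rule ext) (simp add: restrict_def state_tableau_of[OF f] fillings_outside[OF f])
    then show "f \<in> (\<lambda>T. restrict (state T) (inner n)) ` covered_tableaux n"
      using tableau_of_covered[OF f n] by (intro image_eqI[of _ _ "tableau_of n f"]) auto
  qed (auto intro: state_filling)
qed

text \<open>All three conditions are thresholds in the state: nonzero means something above, below
  \<open>3\<close> means something to the left, and \<open>2\<close> against \<open>1\<close> is a
  dot against an empty free cell.\<close>

lemma es_le_of_state_le:
  assumes S: "S \<in> covered_tableaux n" and T: "T \<in> covered_tableaux n"
    and le: "\<And>c. c \<in> inner n \<Longrightarrow> state S c \<le> state T c"
  shows "es_le n S T"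
  unfolding es_le_iff[OF covered_fb[OF S] covered_fb[OF T]]
proof (intro ballI conjI impI)
  fix c assume c: "c \<in> inner n"
  have bound: "state T c \<le> 3" "state S c \<le> 3" by (auto simp: state_def)
  note left = covered_left_iff[OF S c] covered_left_iff[OF T c]
  show above: "has_above T c" if "has_above S c"
    using that le[OF c] unfolding covered_above_iff by linarith
  show left_mono: "has_left S c" if "has_left T c"
    using that le[OF c] bound unfolding left by linarith
  assume *: "has_above S c \<and> has_left T c \<and> c \<in> S"
  then have "state S c = 2" using left_mono by (simp add: state_def)
  then have "state T c = 2" using * le[OF c] bound left(2) by linarith
  then show "c \<in> T" by (simp add: state_def split: if_splits)
qed

section \<open>Chains of maximum length\<close>

text \<open>The height of a state in its chain: \<open>0, 1, 2, 3\<close> for an ordinary cell,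
  while on the border \<open>0, 2, 3\<close> have heights 0, 1, 2.\<close>

definition weight :: "cell \<Rightarrow> nat \<Rightarrow> nat" where
  "weight c v = of_bool (v \<noteq> 0) + of_bool (v = 3) + of_bool (fst c \<noteq> Suc (snd c) \<and> 2 \<le> v)"

definition rank :: "nat \<Rightarrow> (cell \<Rightarrow> nat) \<Rightarrow> nat" where
  "rank n f = (\<Sum>c\<in>inner n. weight c (f c))"

definition max_rank :: "nat \<Rightarrow> nat" where
  "max_rank n = (\<Sum>c\<in>inner n. weight c 3)"

section \<open>Unit steps between fillings\<close>

lemma fillings_upd:
  assumes f: "f \<in> fillings A V" and c: "c \<in> A" "v \<in> V c"
    and "\<And>x. x \<in> A \<Longrightarrow> strictly_above x c \<Longrightarrow> v = 0 \<Longrightarrow> f x = 0"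
    and "\<And>y. y \<in> A \<Longrightarrow> strictly_above c y \<Longrightarrow> f y = 0 \<Longrightarrow> v = 0"
    and "\<And>x. x \<in> A \<Longrightarrow> strictly_left x c \<Longrightarrow> v = 3 \<Longrightarrow> f x = 3"
    and "\<And>y. y \<in> A \<Longrightarrow> strictly_left c y \<Longrightarrow> f y = 3 \<Longrightarrow> v = 3"
  shows "f(c := v) \<in> fillings A V"
proof (rule fillingsI)
  have "(f(c := v)) x \<in> V x" if "x \<in> A" for x using fillings_mem[OF f that] c by simp
  moreover have "(f(c := v)) x = undefined" if "x \<notin> A" for x
    using fillings_outside[OF f that] c that by auto
  ultimately show "f(c := v) \<in> Pi\<^sub>E A V" by (intro PiE_I)
next
  fix x y assume "x \<in> A" "y \<in> A" "strictly_above x y" "(f(c := v)) y = 0"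
  moreover from this have "x \<noteq> y" by (auto simp: strictly_above_def)
  ultimately show "(f(c := v)) x = 0"
    using assms(4)[of x] assms(5)[of y] fillings_above[OF f, of y x]
    by (cases "x = c"; cases "y = c") simp_all
next
  fix x y assume "x \<in> A" "y \<in> A" "strictly_left x y" "(f(c := v)) y = 3"
  moreover from this have "x \<noteq> y" by (auto simp: strictly_left_def)
  ultimately show "(f(c := v)) x = 3"
    using assms(6)[of x] assms(7)[of y] fillings_left[OF f, of y x]
    by (cases "x = c"; cases "y = c") simp_all
qed

lemma rank_upd:
  assumes "c \<in> inner n"
  shows "rank n (f(c := v)) + weight c (f c) = rank n f + weight c v"
proof -
  have "(\<Sum>x\<in>inner n - {c}. weight x ((f(c := v)) x)) = (\<Sum>x\<in>inner n - {c}. weight x (f x))"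
    by (rule sum.cong) auto
  then show ?thesis
    using sum.remove[OF finite_inner assms, of "\<lambda>x. weight x ((f(c := v)) x)"]
      sum.remove[OF finite_inner assms, of "\<lambda>x. weight x (f x)"]
    by (simp add: rank_def)
qed

lemma finite_ex_max:
  fixes g :: "'a \<Rightarrow> nat"
  assumes "finite Z" "z \<in> Z"
  shows "\<exists>c\<in>Z. \<forall>y\<in>Z. g y \<le> g c"
proof -
  have "Max (g ` Z) \<in> g ` Z" using assms by (intro Max_in) auto
  then obtain c where "c \<in> Z" "Max (g ` Z) = g c" by blast
  then show ?thesis using assms(1) by (intro bexI[of _ c]) (auto simp flip: \<open>Max (g ` Z) = g c\<close>)
qed

lemma finite_ex_min:
  fixes g :: "'a \<Rightarrow> nat"
  assumes "finite Z" "z \<in> Z"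
  shows "\<exists>c\<in>Z. \<forall>y\<in>Z. g c \<le> g y"
proof -
  have "Min (g ` Z) \<in> g ` Z" using assms by (intro Min_in) auto
  then obtain c where "c \<in> Z" "Min (g ` Z) = g c" by blast
  then show ?thesis using assms(1) by (intro bexI[of _ c]) (auto simp flip: \<open>Min (g ` Z) = g c\<close>)
qed

lemma filling_values:
  assumes "f \<in> fillings (inner n) state_values" "c \<in> inner n"
  shows "f c \<in> {0, 1, 2, 3}" "fst c = Suc (snd c) \<Longrightarrow> f c \<noteq> 1"
  using fillings_mem[OF assms] by (auto simp: state_values_def split: if_splits)

text \<open>One cell is raised to its next value: zeros first, then ones, and twos become threes
  only when nothing else is left.\<close>

lemma filling_step_up:
  assumes f: "f \<in> fillings (inner n) state_values" and lt: "rank n f < max_rank n"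
  shows "\<exists>c v. c \<in> inner n \<and> f(c := v) \<in> fillings (inner n) state_values \<and> f c \<le> v \<and> rank n (f(c := v)) = Suc (rank n f)"
proof -
  note vals = filling_values[OF f]
  have step: ?thesis if "c \<in> inner n" "f(c := v) \<in> fillings (inner n) state_values" "f c \<le> v"
    "weight c v = Suc (weight c (f c))" for c v
    using that rank_upd[of c n f v] by (intro exI[of _ c] exI[of _ v]) simp
  consider z where "z \<in> inner n" "f z = 0"
    | c where "\<And>z. z \<in> inner n \<Longrightarrow> f z \<noteq> 0" "c \<in> inner n" "f c = 1"
    | "\<And>z. z \<in> inner n \<Longrightarrow> f z = 2 \<or> f z = 3"
    using vals(1) by fastforce
  then show ?thesis
  proof cases
    case 1
    let ?Z = "{c \<in> inner n. f c = 0}"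
    have "finite ?Z" "z \<in> ?Z" using finite_inner 1 by simp_all
    \<comment> \<open>A lowest zero has no zero below it that would force it to stay zero.\<close>
    then obtain c where c: "c \<in> ?Z" and "\<forall>y\<in>?Z. fst y \<le> fst c"
      using finite_ex_max[of ?Z z fst] by blast
    then have max: "fst y \<le> fst c" if "y \<in> ?Z" for y using that by blast
    define v :: nat where "v = (if fst c = Suc (snd c) then 2 else 1)"
    show ?thesis
    proof (rule step)
      show "f(c := v) \<in> fillings (inner n) state_values"
      proof (rule fillings_upd[OF f])
        fix y assume y: "y \<in> inner n" "strictly_above c y" "f y = 0"
        then show "v = 0" using max[of y] by (simp add: strictly_above_def)
      next
        fix y assume y: "y \<in> inner n" "strictly_left c y" "f y = 3"
        then show "v = 3" using fillings_left[OF f, of y c] c by simp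
      qed (use c in \<open>auto simp: v_def state_values_def split: if_splits\<close>)
    qed (use c in \<open>auto simp: v_def weight_def\<close>)
  next
    case 2
    show ?thesis
    proof (rule step)
      show "f(c := 2) \<in> fillings (inner n) state_values"
      proof (rule fillings_upd[OF f])
        fix y assume y: "y \<in> inner n" "strictly_above c y" "f y = 0"
        then show "2 = (0::nat)" using 2 by simp
      next
        fix y assume y: "y \<in> inner n" "strictly_left c y" "f y = 3"
        then show "2 = (3::nat)" using fillings_left[OF f, of y c] 2 by simp
      qed (use 2 in \<open>auto simp: state_values_def\<close>)
    qed (use 2 vals(2)[of c] in \<open>auto simp: weight_def\<close>)
  next
    case 3
    have "\<exists>z\<in>inner n. f z \<noteq> 3"
    proof (rule ccontr)
      assume "\<not> ?thesis"
      then have "rank n f = max_rank n" unfolding rank_def max_rank_def by (intro sum.cong) auto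
      then show False using lt by simp
    qed
    then obtain z where z: "z \<in> inner n" "f z = 2" using 3 by blast
    let ?Z = "{c \<in> inner n. f c = 2}"
    have "finite ?Z" "z \<in> ?Z" using finite_inner z by simp_all
    \<comment> \<open>The largest label is leftmost, so everything to the left of \<open>c\<close>
      is already \<open>3\<close>.\<close>
    then obtain c where c: "c \<in> ?Z" and "\<forall>y\<in>?Z. snd y \<le> snd c"
      using finite_ex_max[of ?Z z snd] by blast
    then have max: "snd y \<le> snd c" if "y \<in> ?Z" for y using that by blast
    show ?thesis
    proof (rule step)
      show "f(c := 3) \<in> fillings (inner n) state_values"
      proof (rule fillings_upd[OF f])
        fix x assume x: "x \<in> inner n" "strictly_left x c"
        then show "f x = 3" using max[of x] 3[of x] by (auto simp: strictly_left_def)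
      next
        fix y assume y: "y \<in> inner n" "strictly_above c y" "f y = 0"
        then show "3 = (0::nat)" using 3[of y] by simp
      qed (use c in \<open>auto simp: state_values_def\<close>)
    qed (use c in \<open>auto simp: weight_def\<close>)
  qed
qed

text \<open>The reverse order: threes first, then twos off the border, and finally the smallest
  nonzero values become zero.\<close>

lemma filling_step_down:
  assumes f: "f \<in> fillings (inner n) state_values" and pos: "rank n f > 0"
  shows "\<exists>c v. c \<in> inner n \<and> f(c := v) \<in> fillings (inner n) state_values \<and> v \<le> f c \<and> Suc (rank n (f(c := v))) = rank n f"
proof -
  note vals = filling_values[OF f]
  have step: ?thesis if "c \<in> inner n" "f(c := v) \<in> fillings (inner n) state_values" "v \<le> f c"
    "Suc (weight c v) = weight c (f c)" for c v
    using that rank_upd[of c n f v] by (intro exI[of _ c] exI[of _ v]) simp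
  consider z where "z \<in> inner n" "f z = 3"
    | c where "\<And>z. z \<in> inner n \<Longrightarrow> f z \<noteq> 3" "c \<in> inner n" "f c = 2" "fst c \<noteq> Suc (snd c)"
    | "\<And>z. z \<in> inner n \<Longrightarrow> f z = 0 \<or> f z = (if fst z = Suc (snd z) then 2 else 1)"
  proof (cases "\<exists>z\<in>inner n. f z = 3 \<or> f z = 2 \<and> fst z \<noteq> Suc (snd z)")
    case True
    then show ?thesis using that(1,2) by metis
  next
    case False
    have "f z = 0 \<or> f z = (if fst z = Suc (snd z) then 2 else 1)" if z: "z \<in> inner n" for z
      using False z vals(1)[OF z] vals(2)[OF z] by (cases "fst z = Suc (snd z)") auto
    then show ?thesis using that(3) by blast
  qed
  then show ?thesis
  proof cases
    case 1
    let ?Z = "{c \<in> inner n. f c = 3}"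
    have "finite ?Z" "z \<in> ?Z" using finite_inner 1 by simp_all
    \<comment> \<open>The smallest label is rightmost, so no three to the right of \<open>c\<close>
      forces it to stay three.\<close>
    then obtain c where c: "c \<in> ?Z" and "\<forall>y\<in>?Z. snd c \<le> snd y"
      using finite_ex_min[of ?Z z snd] by blast
    then have min: "snd c \<le> snd y" if "y \<in> ?Z" for y using that by blast
    show ?thesis
    proof (rule step)
      show "f(c := 2) \<in> fillings (inner n) state_values"
      proof (rule fillings_upd[OF f])
        fix y assume y: "y \<in> inner n" "strictly_above c y" "f y = 0"
        then show "2 = (0::nat)" using fillings_above[OF f, of y c] c by simp
      next
        fix y assume y: "y \<in> inner n" "strictly_left c y" "f y = 3"
        then show "2 = (3::nat)" using min[of y] by (simp add: strictly_left_def)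
      qed (use c in \<open>auto simp: state_values_def split: if_splits\<close>)
    qed (use c in \<open>auto simp: weight_def\<close>)
  next
    case 2
    show ?thesis
    proof (rule step)
      show "f(c := 1) \<in> fillings (inner n) state_values"
      proof (rule fillings_upd[OF f])
        fix y assume y: "y \<in> inner n" "strictly_above c y" "f y = 0"
        then show "1 = (0::nat)" using fillings_above[OF f, of y c] 2 by simp
      next
        fix y assume y: "y \<in> inner n" "strictly_left c y" "f y = 3"
        then show "1 = (3::nat)" using 2 by simp
      qed (use 2 in \<open>auto simp: state_values_def\<close>)
    qed (use 2 in \<open>auto simp: weight_def\<close>)
  next
    case 3
    have "\<exists>z\<in>inner n. f z \<noteq> 0"
    proof (rule ccontr)
      assume "\<not> ?thesis"
      then have "rank n f = 0" unfolding rank_def by (simp add: weight_def)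
      then show False using pos by simp
    qed
    then obtain z where z: "z \<in> inner n" "f z \<noteq> 0" by blast
    let ?Z = "{c \<in> inner n. f c \<noteq> 0}"
    have "finite ?Z" "z \<in> ?Z" using finite_inner z by simp_all
    \<comment> \<open>A topmost nonzero cell has only zeros above it.\<close>
    then obtain c where c: "c \<in> ?Z" and "\<forall>y\<in>?Z. fst c \<le> fst y"
      using finite_ex_min[of ?Z z fst] by blast
    then have min: "fst c \<le> fst y" if "y \<in> ?Z" for y using that by blast
    have fc: "f c = (if fst c = Suc (snd c) then 2 else 1)" using c 3[of c] by (simp only: mem_Collect_eq) metis
    show ?thesis
    proof (rule step)
      show "f(c := 0) \<in> fillings (inner n) state_values"
      proof (rule fillings_upd[OF f])
        fix x assume x: "x \<in> inner n" "strictly_above x c"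
        then show "f x = 0" using min[of x] by (auto simp: strictly_above_def)
      next
        fix y assume y: "y \<in> inner n" "strictly_left c y" "f y = 3"
        then show "0 = (3::nat)" using 3[of y] by (simp split: if_splits)
      qed (use c in \<open>auto simp: state_values_def\<close>)
    qed (use c fc in \<open>auto simp: weight_def\<close>)
  qed
qed

section \<open>Chains in a relation with a numerical potential\<close>

lemma chain_above:
  assumes step: "\<And>x. x \<in> X \<Longrightarrow> g x < N \<Longrightarrow> \<exists>y\<in>X. (x, y) \<in> r \<and> g y = Suc (g x)"
    and r: "refl_on X r" "trans r" and x: "x \<in> X" "g x \<le> (N::nat)"
  shows "\<exists>C. C \<in> Chains r \<and> finite C \<and> x \<in> C \<and> (\<forall>y\<in>C. (x, y) \<in> r \<and> (y = x \<or> g x < g y)) \<and> card C = Suc (N - g x)"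
  using x
proof (induction "N - g x" arbitrary: x)
  case 0
  have "(x, x) \<in> r" using r(1) 0 by (simp add: refl_on_def)
  then show ?case using 0 by (intro exI[of _ "{x}"]) (auto simp: Chains_def)
next
  case (Suc m)
  have xx: "(x, x) \<in> r" using r(1) Suc.prems by (simp add: refl_on_def)
  obtain y where y: "y \<in> X" "(x, y) \<in> r" "g y = Suc (g x)" using step[of x] Suc by force
  obtain C where C: "C \<in> Chains r" "finite C" "\<forall>z\<in>C. (y, z) \<in> r \<and> (z = y \<or> g y < g z)" "card C = Suc (N - g y)"
  proof -
    have "m = N - g y" "g y \<le> N" using Suc.hyps(2) y(3) by auto
    then show ?thesis using that Suc.hyps(1)[of y] y(1) by blast
  qed
  have xz: "(x, z) \<in> r" "g x < g z" if "z \<in> C" for z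
    using C(3) that y r(2) by (auto elim: transE)
  \<comment> \<open>The conclusion records the growth of \<open>g\<close> so that \<open>x\<close>
    is seen to be new here.\<close>
  have "x \<notin> C" using xz by blast
  moreover have "insert x C \<in> Chains r" using C(1) xz xx by (auto simp: Chains_def)
  ultimately show ?case
    using C xz xx y Suc.hyps(2) by (intro exI[of _ "insert x C"]) auto
qed

lemma Chains_converse: "Chains (r\<inverse>) = Chains r"
  by (auto simp: Chains_def)

text \<open>A chain climbing from \<open>x\<close> is joined with one descending from
  \<open>x\<close>, obtained from the converse relation with potential \<open>N - g\<close>. They
  share only \<open>x\<close>, and their sizes are \<open>N - g x + 1\<close> and
  \<open>g x + 1\<close>.\<close>

lemma chain_through:
  assumes up: "\<And>x. x \<in> X \<Longrightarrow> g x < N \<Longrightarrow> \<exists>y\<in>X. (x, y) \<in> r \<and> g y = Suc (g x)"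
    and down: "\<And>x. x \<in> X \<Longrightarrow> g x > 0 \<Longrightarrow> \<exists>y\<in>X. (y, x) \<in> r \<and> Suc (g y) = g x"
    and r: "refl_on X r" "trans r" and le: "\<And>x. x \<in> X \<Longrightarrow> g x \<le> (N::nat)" and x: "x \<in> X"
  shows "\<exists>C \<in> Chains r. x \<in> C \<and> card C = Suc N"
proof -
  obtain C where C: "C \<in> Chains r" "finite C" "x \<in> C" "\<And>y. y \<in> C \<Longrightarrow> (x, y) \<in> r \<and> (y = x \<or> g x < g y)"
      "card C = Suc (N - g x)"
    using chain_above[of X g N r x] up r le x by blast
  have down': "\<exists>y\<in>X. (z, y) \<in> r\<inverse> \<and> N - g y = Suc (N - g z)" if "z \<in> X" "N - g z < N" for z
    using down[of z] le[of z] that by force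
  have "\<exists>C. C \<in> Chains (r\<inverse>) \<and> finite C \<and> x \<in> C \<and>
      (\<forall>y\<in>C. (x, y) \<in> r\<inverse> \<and> (y = x \<or> N - g x < N - g y)) \<and> card C = Suc (N - (N - g x))"
    by (rule chain_above[of X]) (use down' r x in \<open>auto simp: refl_on_def\<close>)
  then obtain D where D: "D \<in> Chains r" "finite D" "x \<in> D" "\<And>y. y \<in> D \<Longrightarrow> (y, x) \<in> r \<and> (y = x \<or> N - g x < N - g y)"
      "card D = Suc (N - (N - g x))"
    unfolding Chains_converse by blast
  have "C \<inter> D = {x}" using C(3,4) D(3,4) by fastforce
  then have "card (C \<union> D) = Suc N"
    using card_Un_Int[OF C(2) D(2)] C(5) D(5) le[OF x] by simp
  moreover have "C \<union> D \<in> Chains r"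
    using C(1,4) D(1,4) r(2) unfolding Chains_def by (blast elim: transE)
  ultimately show ?thesis using C(3) by blast
qed

text \<open>A strictly increasing potential is injective on a chain. If the chain has
  \<open>N + 1\<close> elements, the potential takes every value up to \<open>N\<close>, so its
  value counts the elements below; this number does not depend on the potential.\<close>

lemma card_chain_le:
  assumes C: "C \<in> Chains r" and g: "\<And>x y. x \<in> C \<Longrightarrow> y \<in> C \<Longrightarrow> (x, y) \<in> r \<Longrightarrow> x \<noteq> y \<Longrightarrow> g x < (g y :: nat)"
    and le: "\<And>x. x \<in> C \<Longrightarrow> g x \<le> N"
  shows "card C \<le> Suc N"
    and "card C = Suc N \<Longrightarrow> x \<in> C \<Longrightarrow> g x = card {y \<in> C. y \<noteq> x \<and> (y, x) \<in> r}"
proof -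
  have comp: "(x, y) \<in> r \<or> (y, x) \<in> r" if "x \<in> C" "y \<in> C" for x y
    using C that by (auto simp: Chains_def)
  have inj: "inj_on g C"
  proof (rule inj_onI)
    fix x y assume xy: "x \<in> C" "y \<in> C" "g x = g y"
    then show "x = y" using comp[OF xy(1,2)] g[of x y] g[of y x] by force
  qed
  have sub: "g ` C \<subseteq> {..N}" using le by auto
  have "card (g ` C) \<le> card {..N}" by (rule card_mono) (use sub in auto)
  then show "card C \<le> Suc N" by (simp add: card_image[OF inj])
  assume card: "card C = Suc N" and x: "x \<in> C"
  have surj: "g ` C = {..N}" by (rule card_subset_eq) (use sub card in \<open>auto simp: card_image[OF inj]\<close>)
  have "g ` {y \<in> C. g y < g x} = {..<g x}"
  proof
    show "{..<g x} \<subseteq> g ` {y \<in> C. g y < g x}"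
    proof
      fix k assume k: "k \<in> {..<g x}"
      then have "k \<in> g ` C" using le[OF x] surj by simp
      then show "k \<in> g ` {y \<in> C. g y < g x}" using k by blast
    qed
  qed auto
  moreover have "inj_on g {y \<in> C. g y < g x}" using inj by (rule inj_on_subset) auto
  ultimately have "card {y \<in> C. g y < g x} = g x" by (metis card_image card_lessThan)
  moreover have "g y < g x \<longleftrightarrow> y \<noteq> x \<and> (y, x) \<in> r" if "y \<in> C" for y
    using comp[OF x that] g[OF x that] g[OF that x] by force
  then have "{y \<in> C. g y < g x} = {y \<in> C. y \<noteq> x \<and> (y, x) \<in> r}" by blast
  ultimately show "g x = card {y \<in> C. y \<noteq> x \<and> (y, x) \<in> r}" by simp
qed

text \<open>
  Two potentials which both take every value up to the maximum on a chain of maximum length, and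
  differ only on cells with nothing above and nothing to the left; so a chain of maximum length
  has no such cells.
\<close>

definition cell_potential :: "cell set \<Rightarrow> cell \<Rightarrow> nat" where
  "cell_potential T c = of_bool (has_above T c) + of_bool (\<not> has_left T c) +
    of_bool (fst c \<noteq> Suc (snd c) \<and> (\<not> has_left T c \<or> has_above T c \<and> c \<in> T))"

definition cell_potential' :: "cell set \<Rightarrow> cell \<Rightarrow> nat" where
  "cell_potential' T c = of_bool (has_above T c) + of_bool (\<not> has_left T c) +
    of_bool (fst c \<noteq> Suc (snd c) \<and> has_above T c \<and> (\<not> has_left T c \<or> c \<in> T))"

definition potential :: "nat \<Rightarrow> cell set \<Rightarrow> nat" where
  "potential n T = (\<Sum>c\<in>inner n. cell_potential T c)"

definition potential' :: "nat \<Rightarrow> cell set \<Rightarrow> nat" where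
  "potential' n T = (\<Sum>c\<in>inner n. cell_potential' T c)"

lemma potential_le: "potential n T \<le> max_rank n" "potential' n T \<le> max_rank n"
  unfolding potential_def potential'_def max_rank_def
  by (auto intro!: sum_mono simp: cell_potential_def cell_potential'_def weight_def)

text \<open>An ordinary cell with nothing above and nothing to the left contributes 2 to one
  potential and 1 to the other, in both cases strictly between the contributions of states
  \<open>0\<close> and \<open>3\<close>. So contributions never decrease, and if none increases, all
  data that determine the tableau agree.\<close>

lemma potential_strict:
  assumes S: "fb_tableau n S" and T: "fb_tableau n T" and le: "es_le n S T" and ne: "S \<noteq> T"
  shows "potential n S < potential n T" and "potential' n S < potential' n T"
proof -
  have le: "(has_above S c \<longrightarrow> has_above T c) \<and> (has_left T c \<longrightarrow> has_left S c) \<and>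
      (has_above S c \<and> has_left T c \<and> c \<in> S \<longrightarrow> c \<in> T)" if "c \<in> inner n" for c
    using le that unfolding es_le_iff[OF S T] by blast
  have border: "c \<in> S \<and> c \<in> T" if "c \<in> inner n" "fst c = Suc (snd c)" for c
    using tableau_border[OF S, of "snd c"] tableau_border[OF T, of "snd c"] that by (cases c) auto
  have mono: "cell_potential S c \<le> cell_potential T c" "cell_potential' S c \<le> cell_potential' T c"
    if "c \<in> inner n" for c
    using le[OF that] by (auto simp: cell_potential_def cell_potential'_def)
  have strict: "\<exists>c\<in>inner n. p S c < p T c" if p: "p = cell_potential \<or> p = cell_potential'" for p
  proof (rule ccontr)
    assume "\<not> ?thesis"
    then have ge: "p T c \<le> p S c" if "c \<in> inner n" for c using that by (meson not_less)
    have eq: "has_above S c = has_above T c \<and> has_left S c = has_left T c \<and>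
        (has_above S c \<longrightarrow> has_left S c \<longrightarrow> (c \<in> S \<longleftrightarrow> c \<in> T))" if c: "c \<in> inner n" for c
      using le[OF c] border[OF c] ge[OF c] p
      by (cases "has_above S c"; cases "has_above T c"; cases "has_left S c"; cases "has_left T c";
          cases "c \<in> S"; cases "c \<in> T"; cases "fst c = Suc (snd c)")
        (auto simp: cell_potential_def cell_potential'_def)
    have "S = T" by (rule tableau_eqI[OF S T]) (use eq in auto)
    then show False using ne by simp
  qed
  show "potential n S < potential n T" unfolding potential_def
    by (rule sum_strict_mono_ex1) (use finite_inner mono strict[of cell_potential] in auto)
  show "potential' n S < potential' n T" unfolding potential'_def
    by (rule sum_strict_mono_ex1) (use finite_inner mono strict[of cell_potential'] in auto)
qed

lemma potential_covered:
  assumes "T \<in> covered_tableaux n"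
  shows "potential n T = rank n (state T)"
  unfolding potential_def rank_def
proof (rule sum.cong)
  fix c assume "c \<in> inner n"
  then have "has_above T c \<or> has_left T c" using assms by (simp add: covered_tableaux_def)
  then show "cell_potential T c = weight c (state T c)"
    by (auto simp: cell_potential_def weight_def state_def)
qed simp

section \<open>Chains of maximum length through covered tableaux, and the spine\<close>

lemma rank_restrict: "rank n (restrict f (inner n)) = rank n f"
  by (simp add: rank_def)

lemma covered_step:
  assumes n: "n \<ge> 1" and T: "T \<in> covered_tableaux n"
  shows "potential n T < max_rank n \<Longrightarrow> \<exists>U\<in>covered_tableaux n. es_le n T U \<and> potential n U = Suc (potential n T)"
    and "potential n T > 0 \<Longrightarrow> \<exists>U\<in>covered_tableaux n. es_le n U T \<and> Suc (potential n U) = potential n T"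
proof -
  let ?f = "restrict (state T) (inner n)"
  note f = state_filling[OF T]
  have pot: "potential n T = rank n ?f" by (simp add: potential_covered[OF T] rank_restrict)
  have U: "tableau_of n g \<in> covered_tableaux n" "potential n (tableau_of n g) = rank n g"
      "\<And>c. c \<in> inner n \<Longrightarrow> state (tableau_of n g) c = g c"
    if g: "g \<in> fillings (inner n) state_values" for g
  proof -
    show cov: "tableau_of n g \<in> covered_tableaux n" by (rule tableau_of_covered[OF g n])
    show st: "state (tableau_of n g) c = g c" if "c \<in> inner n" for c by (rule state_tableau_of[OF g that])
    show "potential n (tableau_of n g) = rank n g"
      unfolding potential_covered[OF cov] rank_def by (rule sum.cong) (auto simp: st)
  qed
  show "\<exists>U\<in>covered_tableaux n. es_le n T U \<and> potential n U = Suc (potential n T)"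
    if lt: "potential n T < max_rank n"
  proof -
    obtain c v where c: "c \<in> inner n" "?f(c := v) \<in> fillings (inner n) state_values" "?f c \<le> v"
        "rank n (?f(c := v)) = Suc (rank n ?f)"
      using filling_step_up[OF f lt[unfolded pot]] by blast
    have "es_le n T (tableau_of n (?f(c := v)))"
      by (rule es_le_of_state_le[OF T U(1)[OF c(2)]]) (use U(3)[OF c(2)] c(1,3) in auto)
    then show ?thesis using U(1,2)[OF c(2)] c(4) pot by (intro bexI) auto
  qed
  show "\<exists>U\<in>covered_tableaux n. es_le n U T \<and> Suc (potential n U) = potential n T"
    if pos: "potential n T > 0"
  proof -
    obtain c v where c: "c \<in> inner n" "?f(c := v) \<in> fillings (inner n) state_values" "v \<le> ?f c"
        "Suc (rank n (?f(c := v))) = rank n ?f"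
      using filling_step_down[OF f pos[unfolded pot]] by blast
    have "es_le n (tableau_of n (?f(c := v))) T"
      by (rule es_le_of_state_le[OF U(1)[OF c(2)] T]) (use U(3)[OF c(2)] c(1,3) in auto)
    then show ?thesis using U(1,2)[OF c(2)] c(4) pot by (intro bexI) auto
  qed
qed

text \<open>A condition on cells free in both tableaux need not compose, but here a cell with
  something above in \<open>S\<close> and something to the left in \<open>U\<close> has both in the
  intermediate \<open>T\<close>.\<close>

lemma trans_esTam: "trans (esTam n)"
proof (rule transI)
  fix S T U assume ST: "(S, T) \<in> esTam n" and TU: "(T, U) \<in> esTam n"
  have fb: "fb_tableau n S" "fb_tableau n T" "fb_tableau n U" using ST TU by (auto simp: esTam_def)
  have "es_le n S T" "es_le n T U" using ST TU by (auto simp: esTam_def)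
  then have "es_le n S U"
    unfolding es_le_iff[OF fb(1,2)] es_le_iff[OF fb(2,3)] es_le_iff[OF fb(1,3)] by blast
  then show "(S, U) \<in> esTam n" using fb by (simp add: esTam_def)
qed

text \<open>Unit steps stay among the covered tableaux, so the chain is built in the order
  restricted to them.\<close>

lemma covered_maximal_chain:
  assumes n: "n \<ge> 1" and T: "T \<in> covered_tableaux n"
  shows "\<exists>C \<in> Chains (esTam n). T \<in> C \<and> card C = Suc (max_rank n)"
proof -
  define r where "r = {(S, U) \<in> esTam n. S \<in> covered_tableaux n \<and> U \<in> covered_tableaux n}"
  have "\<exists>C \<in> Chains r. T \<in> C \<and> card C = Suc (max_rank n)"
  proof (rule chain_through[of "covered_tableaux n" "potential n"])
    show "refl_on (covered_tableaux n) r"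
      by (auto simp: refl_on_def r_def esTam_def covered_fb es_le_refl)
    show "trans r"
      using trans_esTam[of n] unfolding r_def trans_def by blast
  qed (use covered_step[OF n] T potential_le covered_fb in \<open>fastforce simp: r_def esTam_def\<close>)+
  then show ?thesis by (auto simp: Chains_def r_def)
qed

text \<open>Every covered tableau lies on a chain attaining the bound. Conversely, on such a chain
  both potentials count the elements below a tableau, so they agree, which rules out uncovered
  cells.\<close>

lemma spine_esTam:
  assumes n: "n \<ge> 1"
  shows "spine (esTam n) = covered_tableaux n"
proof -
  have mono: "potential n S < potential n T" "potential' n S < potential' n T"
    if "(S, T) \<in> esTam n" "S \<noteq> T" for S T
    using that potential_strict[of n S T] by (auto simp: esTam_def)
  have bound: "card C \<le> Suc (max_rank n)" if "C \<in> Chains (esTam n)" for C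
    by (rule card_chain_le(1)[OF that, of "potential n"]) (auto intro: mono potential_le)
  \<comment> \<open>The zero filling provides some covered tableau, so the bound on chains is
    attained.\<close>
  have "(\<lambda>_\<in>inner n. 0) \<in> fillings (inner n) state_values"
    by (rule fillingsI) (auto simp: state_values_def)
  then have "tableau_of n (\<lambda>_\<in>inner n. 0) \<in> covered_tableaux n"
    using n by (rule tableau_of_covered)
  then obtain C0 where C0: "C0 \<in> Chains (esTam n)" "card C0 = Suc (max_rank n)"
    using covered_maximal_chain[OF n] by blast
  have max: "(\<forall>D \<in> Chains (esTam n). card D \<le> card C) \<longleftrightarrow> card C = Suc (max_rank n)"
    if "C \<in> Chains (esTam n)" for C
    using bound C0 that by (metis le_antisym)
  have "T \<in> covered_tableaux n" if C: "C \<in> Chains (esTam n)" "card C = Suc (max_rank n)" and T: "T \<in> C" for C T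
  proof -
    have fb: "fb_tableau n T" using Chains_esTam_subset[OF C(1)] T by blast
    have "potential n T = potential' n T"
      using card_chain_le(2)[of C "esTam n" "potential n", OF C(1) mono(1) potential_le(1) C(2) T]
        card_chain_le(2)[of C "esTam n" "potential' n", OF C(1) mono(2) potential_le(2) C(2) T] by simp
    moreover have le: "cell_potential' T c \<le> cell_potential T c" for c
      by (auto simp: cell_potential_def cell_potential'_def)
    \<comment> \<open>Termwise inequality and equal sums give termwise equality.\<close>
    ultimately have eq: "cell_potential' T c = cell_potential T c" if "c \<in> inner n" for c
      using sum_mono_inv[of "cell_potential' T" "inner n" "cell_potential T" c] that finite_inner
      by (simp add: potential_def potential'_def)
    have "has_above T c \<or> has_left T c" if c: "c \<in> inner n" for c
    proof (cases "fst c = Suc (snd c)")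
      \<comment> \<open>The two potentials always agree on border cells; these are nonempty and
        hence supported by the tableau condition.\<close>
      case True
      then have "c \<in> T" "c \<noteq> (1, n)"
        using tableau_border[OF fb, of "snd c"] c by (cases c; auto simp: inner_iff)+
      then show ?thesis by (rule tableau_supported[OF fb])
    next
      case False
      then show ?thesis
        using eq[OF c] by (cases "has_above T c") (auto simp: cell_potential_def cell_potential'_def)
    qed
    then show ?thesis using fb by (simp add: covered_tableaux_def)
  qed
  moreover have "T \<in> spine (esTam n)" if "T \<in> covered_tableaux n" for T
    using covered_maximal_chain[OF n that] max unfolding spine_def by blast
  ultimately show ?thesis using max unfolding spine_def by blast
qed

theorem theorem7p16:
  fixes n :: nat
  assumes "n \<ge> 1"
  shows "int (card (spine (esTam n))) =
    (\<Sum>(i, j, k) \<in> {(i, j, k). i + j + k = n - 1}. spine_f i j k)"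
  using bij_betw_same_card[OF bij_betw_state[OF assms]] card_fillings_state_values[OF assms]
  by (simp add: spine_esTam[OF assms])

end
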